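(* For every nonnegative integer $n$, the number of signed partitions $\sigma=(\pi,\nu)$ of $n+1$ for which there is an odd positive integer $m$ such that (i) $m$ is a part of $\pi$ (possibly repeated) and every odd part of $\pi$ equals $m$, (ii) $\pi$ has exactly $m-1$ even parts (counted with multiplicity), all of them $\geq m-1$, and (iii) the negative parts are all odd, $<m$, and each value appears at most twice among the negative parts, equals the number of (ordinary) partitions of $n$ into parts congruent to $\pm 1, \pm 4, \pm 6, \pm 8 \pmod{18}$.
   Context: A partition $\lambda$ of length $\ell=\ell(\lambda)$ is an $\ell$-tuple $(\lambda_1,\dots,\lambda_\ell)$ of positive integers (its parts) with $\lambda_i\geq\lambda_{i+1}$ for $1\le i\le \ell-1$; its weight is $|\lambda|=\sum_i\lambda_i$, and it is a partition of $n$ if $|\lambda|=n$. The empty partition (length $0$, weight $0$) is allowed. A signed partition $\sigma$ of an integer $n$ is a pair $(\pi,\nu)$ of partitions with $n=|\pi|-|\nu|$; the parts of $\pi$ are called the positive parts of $\sigma$ and the parts of $\nu$ (which are positive integers) are called the negative parts of $\sigma$. *)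

theory Defs
  imports Main "HOL-Number_Theory.Cong"
begin

text \<open>
  A partition is the weakly decreasing list of its (positive) parts; its length and weight
  are \<open>length\<close> and \<open>sum_list\<close>.
\<close>

definition is_partition :: "nat list \<Rightarrow> bool" where
  "is_partition xs \<longleftrightarrow> sorted_wrt (\<ge>) xs \<and> (\<forall>x\<in>set xs. x > 0)"

definition partitions_of :: "nat \<Rightarrow> nat list set" where
  "partitions_of n = {xs. is_partition xs \<and> sum_list xs = n}"

definition signed_partitions_of :: "int \<Rightarrow> (nat list \<times> nat list) set" where
  "signed_partitions_of n =
     {(\<pi>, \<nu>). is_partition \<pi> \<and> is_partition \<nu> \<and> n = int (sum_list \<pi>) - int (sum_list \<nu>)}"

end

theory Submission
  imports Defs "HOL-Computational_Algebra.Formal_Laurent_Series" "HOL-Library.Multiset"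
begin

text \<open>
  Write \<open>(a; b)\<^sub>n\<close> for the product of the factors \<open>1 - a b ^ i\<close> with \<open>i < n\<close>, and sort the signed partitions by
  the number \<open>k\<close> with \<open>m = 2 k + 1\<close>. The copies of \<open>m\<close> contribute \<open>q ^ (2 k + 1) / (1 - q ^ (2 k + 1))\<close> to the
  generating function, the \<open>2 k\<close> even parts contribute \<open>q ^ (4 k\<^sup>2) / (q\<^sup>2; q\<^sup>2)\<close> with a denominator of order
  \<open>2 k\<close>, and the negative parts contribute the product of \<open>1 + q ^ (- j) + q ^ (- 2 j)\<close> over the odd \<open>j < 2 k + 1\<close>.
  Complementing the negative parts turns the last product into \<open>q ^ (- 2 k\<^sup>2)\<close> times the polynomial \<open>cubic_poch q k\<close>,
  the product of the \<open>1 + q ^ j + q ^ (2 j)\<close>. Without the factor \<open>q\<close> that accounts for \<open>n + 1\<close> in place of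
  \<open>n\<close>, the theorem says that the sum over \<open>k\<close> of
  \<open>q ^ (2 k (k + 1)) cubic_poch q k / ((1 - q ^ (2 k + 1)) (q\<^sup>2; q\<^sup>2))\<close>, again with a factorial of order \<open>2 k\<close>, is the
  product of the \<open>1 / (1 - q ^ s)\<close> with \<open>s\<close> congruent to \<open>\<plusminus>1, \<plusminus>4, \<plusminus>6, \<plusminus>8\<close> modulo 18. This is an identity of
  Rogers-Ramanujan type from the circle of Slater's identities modulo 18 (\<open>Slater_mod_18_upto\<close>).

  The sum side becomes a theta series by Bailey's lemma. The factors of \<open>cubic_poch q k\<close> split over the third roots of unity,
  so the triple product identity expands it over q-binomial coefficients with coefficients \<open>1, 0, - 1\<close> of period three
  (\<open>cubic_poch_Bailey_pair\<close>); inserting this expansion and summing over \<open>k\<close> by a Durfee rectangle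
  (\<open>finite_Durfee\<close>) leaves the theta series divided by \<open>(q\<^sup>2; q\<^sup>2)\<^sub>\<infinity>\<close>. That theta series is the one of the quintuple product
  identity in base \<open>q ^ 18\<close> at \<open>z = q\<close>, hence equal to
  \<open>(q ^ 18, q\<^sup>2, q ^ 16; q ^ 18)\<^sub>\<infinity> / (q, q ^ 17; q ^ 18)\<^sub>\<infinity>\<close>, and the product follows by sorting the factors of
  \<open>(q\<^sup>2; q\<^sup>2)\<^sub>\<infinity>\<close> modulo 18.

  Each of these identities is proved in a finite form, valid in any field in which the denominators do not vanish and, for
  the Bailey pair, a primitive third root of unity exists. The quintuple
  product identity comes from a terminating sum that telescopes (\<open>finite_quintuple_product\<close>). The finite identities are
  specialised to formal Laurent series, transferred to formal power series, and compared modulo a power of the indeterminate; no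
  infinite sum or product occurs.
\<close>

section \<open>q-shifted factorials and q-binomial coefficients\<close>

text \<open>
  The q-shifted factorial \<open>(a; b)\<^sub>n\<close> of base \<open>b\<close>.
\<close>

definition qpoch :: "'a::comm_ring_1 \<Rightarrow> 'a \<Rightarrow> nat \<Rightarrow> 'a" where
  "qpoch a b n = (\<Prod>i<n. 1 - a * b ^ i)"

text \<open>
  The finite identities hold in every field as long as no factor \<open>1 - b ^ n\<close> vanishes; they are
  used in the field of formal Laurent series, where the base is a power of the indeterminate.
\<close>

definition nonroot :: "'a::field \<Rightarrow> bool" where
  "nonroot b \<longleftrightarrow> b \<noteq> 0 \<and> (\<forall>n>0. b ^ n \<noteq> 1)"

text \<open>
  The reciprocal \<open>1 / (b; b)\<^sub>n\<close>, in a type class that covers both fields and formal power series over a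
  field, so that the same notation serves before and after the passage to power series.
\<close>

definition rfac :: "'a::{comm_ring_1,inverse} \<Rightarrow> nat \<Rightarrow> 'a" where
  "rfac b n = inverse (qpoch b b n)"

definition qbinom :: "'a::field \<Rightarrow> nat \<Rightarrow> nat \<Rightarrow> 'a" where
  "qbinom b n k = (if k \<le> n then qpoch b b n * rfac b k * rfac b (n - k) else 0)"

lemma qpoch_0 [simp]: "qpoch a b 0 = 1"
  by (simp add: qpoch_def)

lemma qpoch_Suc: "qpoch a b (Suc n) = (1 - a * b ^ n) * qpoch a b n"
  by (simp add: qpoch_def mult.commute)

lemma qpoch_Suc_left: "qpoch a b (Suc n) = (1 - a) * qpoch (a * b) b n"
  unfolding qpoch_def by (subst prod.lessThan_Suc_shift) (simp add: mult.assoc)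

lemma nonroot_power: "nonroot b \<Longrightarrow> k > 0 \<Longrightarrow> nonroot (b ^ k)"
  unfolding nonroot_def by (simp flip: power_mult)

lemma qpoch_nonzero: "nonroot b \<Longrightarrow> qpoch b b n \<noteq> 0"
  unfolding nonroot_def qpoch_def by (auto simp flip: power_Suc)

lemma rfac_0 [simp]: "rfac (b :: 'a::field) 0 = 1"
  by (simp add: rfac_def)

lemma rfac_Suc: "nonroot b \<Longrightarrow> (1 - b ^ Suc n) * rfac b (Suc n) = rfac b n"
  using qpoch_nonzero[of b n] qpoch_nonzero[of b "Suc n"]
  by (simp add: rfac_def qpoch_Suc field_simps)

lemma qbinom_0 [simp]: "nonroot b \<Longrightarrow> qbinom b n 0 = 1"
  using qpoch_nonzero[of b n] by (simp add: qbinom_def rfac_def)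

text \<open>
  The two Pascal rules reflect the two splittings of \<open>1 - b ^ (n + 1)\<close> into a multiple of
  \<open>1 - b ^ (n - k)\<close> and a multiple of \<open>1 - b ^ (k + 1)\<close>; for \<open>k > n\<close> all terms are zero.
\<close>

lemma qbinom_Suc_Suc:
  assumes b: "nonroot b"
  shows "qbinom b (Suc n) (Suc k) = qbinom b n (Suc k) + b ^ (n - k) * qbinom b n k"
    and "qbinom b (Suc n) (Suc k) = b ^ Suc k * qbinom b n (Suc k) + qbinom b n k"
proof -
  consider "k < n" | "k = n" | "k > n" by linarith
  then have "qbinom b (Suc n) (Suc k) = qbinom b n (Suc k) + b ^ (n - k) * qbinom b n k \<and>
    qbinom b (Suc n) (Suc k) = b ^ Suc k * qbinom b n (Suc k) + qbinom b n k"
  proof cases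
    case 1
    then obtain d where n: "n = Suc (k + d)" by (metis less_iff_Suc_add)
    define u where "u = qpoch b b n * rfac b (Suc k) * rfac b (Suc d)"
    have "qbinom b n (Suc k) = (1 - b ^ Suc d) * u" "qbinom b n k = (1 - b ^ Suc k) * u"
      using rfac_Suc[OF b, of d, symmetric] rfac_Suc[OF b, of k, symmetric]
      by (simp_all add: qbinom_def n u_def Suc_diff_le)
    moreover have "qbinom b (Suc n) (Suc k) = (1 - b ^ Suc n) * u"
      by (simp add: qbinom_def n u_def qpoch_Suc Suc_diff_le)
    moreover have "b ^ Suc n = b ^ Suc d * b ^ Suc k"
      by (simp add: n power_add)
    moreover have "n - k = Suc d" using n by simp
    ultimately show ?thesis by (simp only:) (simp add: algebra_simps)
  next
    case 2
    then show ?thesis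
      using qpoch_nonzero[OF b, of n] qpoch_nonzero[OF b, of "Suc n"]
      by (simp add: qbinom_def rfac_def)
  next
    case 3
    then show ?thesis by (simp add: qbinom_def)
  qed
  then show "qbinom b (Suc n) (Suc k) = qbinom b n (Suc k) + b ^ (n - k) * qbinom b n k"
    and "qbinom b (Suc n) (Suc k) = b ^ Suc k * qbinom b n (Suc k) + qbinom b n k" by auto
qed

text \<open>
  Induction steps for sums over q-binomial coefficients: each Pascal rule moves a weight \<open>F\<close> from row
  \<open>n + 1\<close> to row \<open>n\<close>, so that an identity is proved once its weight satisfies a two-term recurrence.
\<close>

lemma sum_qbinom_Suc:
  assumes b: "nonroot b"
  shows "(\<Sum>k\<le>Suc n. F k * qbinom b (Suc n) k) = (\<Sum>k\<le>n. (F k + b ^ (n - k) * F (Suc k)) * qbinom b n k)"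
    and "(\<Sum>k\<le>Suc n. F k * qbinom b (Suc n) k) = (\<Sum>k\<le>n. (b ^ k * F k + F (Suc k)) * qbinom b n k)"
proof -
  have top: "qbinom b n (Suc n) = 0" by (simp add: qbinom_def)
  have shift: "F 0 + (\<Sum>k\<le>n. c (Suc k) * F (Suc k) * qbinom b n (Suc k))
      = (\<Sum>k\<le>n. c k * F k * qbinom b n k)" if "c 0 = 1" for c
    using sum.atMost_Suc_shift[of "\<lambda>k. c k * F k * qbinom b n k" n] b that
    by (simp add: top)
  show "(\<Sum>k\<le>Suc n. F k * qbinom b (Suc n) k) = (\<Sum>k\<le>n. (F k + b ^ (n - k) * F (Suc k)) * qbinom b n k)"
    using shift[of "\<lambda>_. 1"] b
    by (subst sum.atMost_Suc_shift)
      (simp add: qbinom_Suc_Suc(1) algebra_simps sum.distrib)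
  show "(\<Sum>k\<le>Suc n. F k * qbinom b (Suc n) k) = (\<Sum>k\<le>n. (b ^ k * F k + F (Suc k)) * qbinom b n k)"
    using shift[of "\<lambda>k. b ^ k"] b
    by (subst sum.atMost_Suc_shift)
      (simp add: qbinom_Suc_Suc(2) algebra_simps sum.distrib)
qed

text \<open>
  A finite form of the decomposition of a partition by its Durfee rectangle. The recurrence
  of \<open>sum_qbinom_Suc(2)\<close> turns the sum for \<open>(M + 1, c)\<close> into the sum for \<open>(M, c + 1)\<close>, and the right-hand
  side depends on \<open>M + c\<close> only apart from the factor \<open>1 / (b; b)\<^sub>M\<close>.
\<close>

lemma finite_Durfee:
  assumes b: "nonroot b"
  shows "(\<Sum>j\<le>M. b ^ (j * (j + c)) * rfac b j * rfac b (M - j) * rfac b (j + c))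
    = rfac b M * rfac b (M + c)"
proof -
  have *: "(\<Sum>j\<le>M. (b ^ (j * (j + c)) * rfac b (j + c)) * qbinom b M j) = rfac b (M + c)" for c
  proof (induction M arbitrary: c)
    case 0
    show ?case using b by simp
  next
    case (Suc M)
    have "(b ^ j * (b ^ (j * (j + c)) * rfac b (j + c)) + b ^ (Suc j * (Suc j + c)) * rfac b (Suc j + c))
        = b ^ (j * (j + Suc c)) * rfac b (j + Suc c)" for j
    proof -
      have r: "rfac b (j + c) = (1 - b ^ Suc (j + c)) * rfac b (Suc (j + c))"
        using rfac_Suc[OF b] by simp
      show ?thesis
        by (simp only: add_Suc add_Suc_right r) (simp add: algebra_simps power_add)
    qed
    then show ?case
      using Suc.IH[of "Suc c"] by (subst sum_qbinom_Suc(2)[OF b]) (simp add: mult.commute)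
  qed
  have "rfac b M * rfac b (M + c)
      = (\<Sum>j\<le>M. rfac b M * ((b ^ (j * (j + c)) * rfac b (j + c)) * qbinom b M j))"
    by (simp add: * flip: sum_distrib_left)
  also have "\<dots> = (\<Sum>j\<le>M. b ^ (j * (j + c)) * rfac b j * rfac b (M - j) * rfac b (j + c))"
    using qpoch_nonzero[OF b, of M]
    by (intro sum.cong) (simp_all add: qbinom_def rfac_def[of b M] field_simps)
  finally show ?thesis by simp
qed

text \<open>
  Adding one factor on either side is one of the two Pascal rules, so both \<open>a\<close> and
  \<open>b\<close> are reached by induction. With \<open>s = k - b\<close> the sum is the truncated theta series of the terms
  \<open>(- x) ^ s q ^ (s\<^sup>2)\<close>.
\<close>

lemma finite_Jacobi_triple_product:
  assumes q: "nonroot (q ^ 2)" and x: "x \<noteq> 0"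
  shows "qpoch (x * q) (q ^ 2) a * qpoch (q / x) (q ^ 2) b =
    (\<Sum>k\<le>a + b. (- x) powi (int k - int b) * q powi ((int k - int b)\<^sup>2) * qbinom (q ^ 2) (a + b) k)"
proof -
  have q0: "q \<noteq> 0" using q by (auto simp: nonroot_def)
  define F where "F b k = (- x) powi (int k - int b) * q powi ((int k - int b)\<^sup>2)" for b k :: nat
  have stepa: "F b k + (q ^ 2) ^ (a + b - k) * F b (Suc k) = (1 - (x * q) * (q ^ 2) ^ a) * F b k"
    if "k \<le> a + b" for a b k
  proof -
    have e1: "(q ^ 2) ^ (a + b - k) = q powi (2 * (int a + int b - int k))"
      using that power_int_of_nat[of q "2 * (a + b - k)"] by (simp add: of_nat_diff power_mult)
    have "q powi (2 * (int a + int b - int k)) * q powi ((int (Suc k) - int b)\<^sup>2)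
        = q powi (2 * int a + 1) * q powi ((int k - int b)\<^sup>2)"
      using q0 by (simp add: power2_eq_square algebra_simps flip: power_int_add)
    moreover have "(- x) powi (int (Suc k) - int b) = (- x) * (- x) powi (int k - int b)"
      using x power_int_add[of "- x" 1 "int k - int b"] by (simp add: algebra_simps)
    moreover have "q powi (2 * int a + 1) = q * (q ^ 2) ^ a"
      using q0 power_int_of_nat[of q "2 * a + 1"] by (simp add: power_mult add.commute)
    ultimately show ?thesis
      unfolding F_def e1 by (simp add: algebra_simps)
  qed
  have stepb: "(q ^ 2) ^ k * F (Suc b) k + F (Suc b) (Suc k) = (1 - (q / x) * (q ^ 2) ^ b) * F b k"
    for b k
  proof -
    have e1: "(q ^ 2) ^ k = q powi (2 * int k)"
      using power_int_of_nat[of q "2 * k"] by (simp add: power_mult)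
    have "q powi (2 * int k) * q powi ((int k - int (Suc b))\<^sup>2)
        = q powi (2 * int b + 1) * q powi ((int k - int b)\<^sup>2)"
      using q0 by (simp add: power2_eq_square algebra_simps flip: power_int_add)
    moreover have "(- x) powi (int k - int b) = (- x) * (- x) powi (int k - int (Suc b))"
      using x power_int_add[of "- x" 1 "int k - int (Suc b)"] by (simp add: algebra_simps)
    moreover have "q powi (2 * int b + 1) = q * (q ^ 2) ^ b"
      using q0 power_int_of_nat[of q "2 * b + 1"] by (simp add: power_mult add.commute)
    moreover have "F (Suc b) (Suc k) = F b k" by (simp add: F_def)
    ultimately show ?thesis
      unfolding e1 using x by (simp add: F_def field_simps)
  qed
  have "qpoch (x * q) (q ^ 2) a * qpoch (q / x) (q ^ 2) b = (\<Sum>k\<le>a + b. F b k * qbinom (q ^ 2) (a + b) k)"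
  proof (induction a)
    case 0
    show ?case
    proof (induction b)
      case 0
      show ?case using q by (simp add: F_def)
    next
      case (Suc b)
      have "(\<Sum>k\<le>Suc b. F (Suc b) k * qbinom (q ^ 2) (Suc b) k)
          = (\<Sum>k\<le>b. (1 - (q / x) * (q ^ 2) ^ b) * F b k * qbinom (q ^ 2) b k)"
        unfolding sum_qbinom_Suc(2)[OF q] stepb ..
      then show ?case using Suc by (simp add: qpoch_Suc mult.assoc flip: sum_distrib_left)
    qed
  next
    case (Suc a)
    have "(\<Sum>k\<le>Suc (a + b). F b k * qbinom (q ^ 2) (Suc (a + b)) k)
        = (\<Sum>k\<le>a + b. (1 - (x * q) * (q ^ 2) ^ a) * F b k * qbinom (q ^ 2) (a + b) k)"
      unfolding sum_qbinom_Suc(1)[OF q] by (intro sum.cong) (auto simp: stepa)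
    then show ?case using Suc by (simp add: qpoch_Suc mult.assoc flip: sum_distrib_left)
  qed
  then show ?thesis by (simp add: F_def)
qed

section \<open>The Bailey pair of the cubic product\<close>

text \<open>
  The coefficients \<open>1, 0, - 1\<close>, repeated with period three; \<open>sgn3_root\<close> shows how they come from a
  primitive third root of unity \<open>x\<close>, as \<open>(x ^ (- r) - x ^ (r + 1)) / (1 - x)\<close>.
\<close>

definition sgn3 :: "nat \<Rightarrow> 'a::ring_1" where
  "sgn3 r = (if r mod 3 = 0 then 1 else if r mod 3 = 1 then 0 else - 1)"

text \<open>
  This is \<open>(q\<^sup>3; q\<^sup>6)\<^sub>n / (q; q\<^sup>2)\<^sub>n\<close>, written without a division.
\<close>

definition cubic_poch :: "'a::comm_ring_1 \<Rightarrow> nat \<Rightarrow> 'a" where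
  "cubic_poch q n = (\<Prod>i<n. 1 + q ^ (2 * i + 1) + q ^ (4 * i + 2))"

lemma sum_fold_middle:
  fixes n :: nat
  shows "(\<Sum>k\<le>2 * n + 1. f k) = (\<Sum>r\<le>n. f (n - r) + f (n + 1 + r))"
proof -
  have "(\<Sum>k\<le>2 * n + 1. f k) = (\<Sum>k\<in>{..n}. f k) + (\<Sum>k\<in>{n + 1..2 * n + 1}. f k)"
    by (subst sum.union_disjoint[symmetric]) (auto intro!: sum.cong simp del: sum.atMost_Suc)
  also have "(\<Sum>k\<in>{..n}. f k) = (\<Sum>r\<le>n. f (n - r))"
    by (rule sum.reindex_bij_witness[of _ "\<lambda>r. n - r" "\<lambda>r. n - r"]) auto
  also have "(\<Sum>k\<in>{n + 1..2 * n + 1}. f k) = (\<Sum>r\<le>n. f (n + 1 + r))"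
    by (rule sum.reindex_bij_witness[of _ "\<lambda>r. n + 1 + r" "\<lambda>k. k - (n + 1)"]) auto
  finally show ?thesis by (simp add: sum.distrib)
qed

text \<open>
  The hypotheses say that \<open>x\<close> and \<open>y\<close> are the two roots of \<open>t\<^sup>2 + t + 1\<close>, and
  \<open>1 + u + u\<^sup>2 = (1 - x u) (1 - y u)\<close>.
\<close>

lemma qpoch_conjugates:
  fixes q x y :: "'a::field"
  assumes "x * y = 1" "x + y = - 1"
  shows "qpoch (x * q) (q ^ 2) n * qpoch (y * q) (q ^ 2) n = cubic_poch q n"
proof -
  have "(1 - x * q * (q ^ 2) ^ i) * (1 - y * q * (q ^ 2) ^ i) = 1 + q ^ (2 * i + 1) + q ^ (4 * i + 2)" for i
  proof -
    define u where "u = q * (q ^ 2) ^ i"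
    have u: "q ^ (2 * i + 1) = u"
      by (simp add: u_def power_mult[symmetric] del: power_even_eq)
    have "q ^ (4 * i + 2) = q ^ ((2 * i + 1) + (2 * i + 1))" by (rule arg_cong[of _ _ "(^) q"]) simp
    then have u2: "q ^ (4 * i + 2) = u * u" by (simp only: power_add[of q "2 * i + 1" "2 * i + 1"] u)
    have "(1 - x * u) * (1 - y * u) = 1 - (x + y) * u + (x * y) * (u * u)"
      by (simp add: algebra_simps)
    then show ?thesis unfolding u u2 using assms by (simp add: u_def mult.assoc)
  qed
  then show ?thesis
    by (simp add: qpoch_def cubic_poch_def flip: prod.distrib)
qed

text \<open>
  The triple product at a third root of unity \<open>x\<close>, with one factor more on the side
  of \<open>x q\<close> than on that of \<open>q / x\<close>. The terms of index \<open>n - r\<close> and \<open>n + 1 + r\<close> carry the same q-binomial coefficient and are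
  put together, which leaves a sum over natural \<open>r\<close>.
\<close>

lemma cubic_poch_expansion_at_root:
  fixes q x y :: "'a::field"
  assumes q: "nonroot (q ^ 2)" and xy: "x * y = 1" "x + y = - 1"
  shows "(1 - x * q ^ (2 * n + 1)) * cubic_poch q n =
    (\<Sum>r\<le>n. ((- y) ^ r * q ^ r\<^sup>2 + (- x) ^ Suc r * q ^ (Suc r)\<^sup>2) * qbinom (q ^ 2) (2 * n + 1) (n - r))"
proof -
  have x0: "x \<noteq> 0" and y: "y = inverse x" using xy(1) by (auto simp: inverse_unique)
  have fold: "(- x) powi (int (n - r) - int n) * q powi ((int (n - r) - int n)\<^sup>2) *
          qbinom (q\<^sup>2) (2 * n + 1) (n - r) +
          (- x) powi (int (n + 1 + r) - int n) * q powi ((int (n + 1 + r) - int n)\<^sup>2) *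
          qbinom (q\<^sup>2) (2 * n + 1) (n + 1 + r) =
          ((- y) ^ r * q ^ r\<^sup>2 + (- x) ^ Suc r * q ^ (Suc r)\<^sup>2) * qbinom (q\<^sup>2) (2 * n + 1) (n - r)"
    if "r \<in> {..n}" for r
  proof -
    have r: "r \<le> n" using that by simp
    have s: "qbinom (q ^ 2) (2 * n + 1) (n + 1 + r) = qbinom (q ^ 2) (2 * n + 1) (n - r)"
    proof -
      have "2 * n + 1 - (n + 1 + r) = n - r" "2 * n + 1 - (n - r) = n + 1 + r" using r by auto
      moreover have "n + 1 + r \<le> 2 * n + 1" "n - r \<le> 2 * n + 1" using r by auto
      ultimately show ?thesis by (simp only: qbinom_def if_True mult_ac)
    qed
    have "(- x) powi (int (n - r) - int n) = (- y) ^ r"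
    proof -
      have "int (n - r) - int n = - int r" using r by (simp add: of_nat_diff)
      moreover have "- y = inverse (- x)" by (simp add: y)
      ultimately show ?thesis by (simp only: power_int_minus power_int_of_nat power_inverse)
    qed
    moreover have "q powi ((int (n - r) - int n)\<^sup>2) = q ^ r\<^sup>2"
      using r power_int_of_nat[of q "r\<^sup>2"] by (simp add: of_nat_diff)
    moreover have "(- x) powi (int (n + 1 + r) - int n) = (- x) ^ Suc r"
      using power_int_of_nat[of "- x" "Suc r"] by (simp add: add.commute)
    moreover have "q powi ((int (n + 1 + r) - int n)\<^sup>2) = q ^ (Suc r)\<^sup>2"
      using power_int_of_nat[of q "(Suc r)\<^sup>2"] by (simp add: add.commute)
    ultimately show ?thesis
      unfolding s by (simp only: distrib_right)
  qed
  have "(1 - x * q ^ (2 * n + 1)) * cubic_poch q n = qpoch (x * q) (q ^ 2) (Suc n) * qpoch (q / x) (q ^ 2) n"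
  proof -
    have "q ^ (2 * n + 1) = q * (q ^ 2) ^ n"
      by (simp add: power_mult[symmetric] del: power_even_eq)
    then show ?thesis
      using qpoch_conjugates[OF xy, of q n, symmetric]
      by (simp only: qpoch_Suc y divide_inverse) (simp only: ac_simps)
  qed
  also have "\<dots> = (\<Sum>k\<le>2 * n + 1. (- x) powi (int k - int n) * q powi ((int k - int n)\<^sup>2)
      * qbinom (q ^ 2) (2 * n + 1) k)"
  proof -
    have "Suc n + n = 2 * n + 1" by simp
    then show ?thesis using finite_Jacobi_triple_product[OF q x0, of "Suc n" n] by (simp only:)
  qed
  also have "\<dots> = (\<Sum>r\<le>n. ((- y) ^ r * q ^ r\<^sup>2 + (- x) ^ Suc r * q ^ (Suc r)\<^sup>2)
      * qbinom (q ^ 2) (2 * n + 1) (n - r))"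
    by (subst sum_fold_middle, rule sum.cong[OF refl]) (rule fold)
  finally show ?thesis .
qed

lemma sgn3_root:
  fixes x y :: "'a::field"
  assumes xy: "x * y = 1" "x + y = - 1"
  shows "y ^ r - x ^ Suc r = (1 - x) * sgn3 r"
proof -
  have y: "y = - 1 - x" using xy(2) by (simp add: eq_diff_eq add.commute)
  have "x * x = - x - x * y" unfolding y by (simp add: algebra_simps)
  then have x2: "x * x = y" using xy(1) by (simp add: y)
  have y2: "y * y = x" using xy(1) x2 by (metis mult.assoc mult.commute mult.right_neutral)
  have x3: "x ^ 3 = 1" and y3: "y ^ 3 = 1"
    using xy(1) by (simp_all add: power3_eq_cube mult.assoc x2 y2 mult.commute)
  define s t where "s = r div 3" and "t = r mod 3"
  have r: "r = 3 * s + t" and t: "t = 0 \<or> t = 1 \<or> t = 2" by (auto simp: s_def t_def)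
  have "y ^ r - x ^ Suc r = y ^ t - x ^ Suc t"
    by (simp only: r power_Suc power_add power_mult x3 y3 power_one mult_1_left)
  also have "\<dots> = (1 - x) * sgn3 r"
    using t
  proof (elim disjE)
    assume "t = 2"
    then show ?thesis
      using xy(1) by (simp add: sgn3_def t_def[symmetric] power2_eq_square y2 x2 x3)
  qed (simp_all add: sgn3_def t_def[symmetric] x2)
  finally show ?thesis .
qed

text \<open>
  For \<open>x = w\<close> and \<open>x = v = w\<^sup>2\<close>, \<open>cubic_poch_expansion_at_root\<close> has the unwanted factor
  \<open>1 - x u\<close> with \<open>u = q ^ (2 n + 1)\<close>. The combination \<open>(1 - w u) - w (1 - v u) = (1 - w) (1 + u)\<close> replaces it by
  \<open>1 + u\<close>, and it reduces the powers of the roots to the integers \<open>sgn3 r\<close>.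
\<close>

lemma cubic_poch_expansion:
  fixes q w :: "'a::field"
  assumes q: "nonroot (q ^ 2)" and w: "w * w + w + 1 = 0" "w \<noteq> 1"
  shows "(1 + q ^ (2 * n + 1)) * cubic_poch q n =
    (\<Sum>r\<le>n. (- 1) ^ r * sgn3 r * (q ^ r\<^sup>2 + q ^ (Suc r)\<^sup>2) * qbinom (q ^ 2) (2 * n + 1) (n - r))"
proof -
  define v where "v = w * w"
  define u where "u = q ^ (2 * n + 1)"
  define c where "c r = qbinom (q ^ 2) (2 * n + 1) (n - r)" for r
  have sum: "w + v = - 1" using w(1) by (simp add: v_def eq_neg_iff_add_eq_0 add_ac)
  have prod: "w * v = 1"
  proof -
    have "w * w * w - 1 = (w - 1) * (w * w + w + 1)" by (simp add: algebra_simps)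
    then show ?thesis using w(1) by (simp add: v_def mult.assoc)
  qed
  have E1: "(1 - w * u) * cubic_poch q n =
      (\<Sum>r\<le>n. ((- v) ^ r * q ^ r\<^sup>2 + (- w) ^ Suc r * q ^ (Suc r)\<^sup>2) * c r)"
    unfolding u_def c_def by (rule cubic_poch_expansion_at_root[OF q prod sum])
  have E2: "(1 - v * u) * cubic_poch q n =
      (\<Sum>r\<le>n. ((- w) ^ r * q ^ r\<^sup>2 + (- v) ^ Suc r * q ^ (Suc r)\<^sup>2) * c r)"
    unfolding u_def c_def using prod sum by (intro cubic_poch_expansion_at_root[OF q]) (simp_all add: ac_simps)
  \<comment> \<open>The same scalar comes out of both halves because \<open>w v = 1\<close>.\<close>
  have coef: "((- v) ^ r * A + (- w) ^ Suc r * B) - w * ((- w) ^ r * A + (- v) ^ Suc r * B)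
      = (1 - w) * ((- 1) ^ r * sgn3 r * (A + B))" for r A B
  proof -
    have vw: "w * v ^ Suc r = v ^ r" using prod by (simp add: mult.assoc[symmetric])
    have m: "(- v) ^ r = (- 1) ^ r * v ^ r" "(- w) ^ r = (- 1) ^ r * w ^ r"
      "(- w) ^ Suc r = - ((- 1) ^ r * w ^ Suc r)" "(- v) ^ Suc r = - ((- 1) ^ r * v ^ Suc r)"
      by (simp_all add: power_minus[of v] power_minus[of w])
    have "((- v) ^ r * A + (- w) ^ Suc r * B) - w * ((- w) ^ r * A + (- v) ^ Suc r * B)
      = (- 1) ^ r * ((v ^ r - w ^ Suc r) * A + (w * v ^ Suc r - w ^ Suc r) * B)"
      unfolding m by (simp add: algebra_simps)
    also have "\<dots> = (- 1) ^ r * ((v ^ r - w ^ Suc r) * (A + B))"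
      unfolding vw by (simp add: algebra_simps)
    also have "\<dots> = (1 - w) * ((- 1) ^ r * sgn3 r * (A + B))"
      unfolding sgn3_root[OF prod sum] by (simp add: ac_simps)
    finally show ?thesis .
  qed
  have "(1 - w) * ((1 + u) * cubic_poch q n) = (1 - w * u) * cubic_poch q n - w * ((1 - v * u) * cubic_poch q n)"
    using prod by (simp add: algebra_simps)
  also have "\<dots> = (\<Sum>r\<le>n. (((- v) ^ r * q ^ r\<^sup>2 + (- w) ^ Suc r * q ^ (Suc r)\<^sup>2)
      - w * ((- w) ^ r * q ^ r\<^sup>2 + (- v) ^ Suc r * q ^ (Suc r)\<^sup>2)) * c r)"
    unfolding E1 E2 by (simp only: sum_distrib_left left_diff_distrib sum_subtractf mult.assoc)
  also have "\<dots> = (1 - w) * (\<Sum>r\<le>n. (- 1) ^ r * sgn3 r * (q ^ r\<^sup>2 + q ^ (Suc r)\<^sup>2) * c r)"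
    unfolding coef by (simp only: sum_distrib_left mult.assoc)
  finally show ?thesis using w(2) by (simp add: u_def c_def)
qed

text \<open>
  Dividing \<open>cubic_poch_expansion\<close> by \<open>(q\<^sup>2; q\<^sup>2)\<close> of order \<open>2 n + 1\<close>, whose last factor is
  \<open>(1 - q ^ (2 n + 1)) (1 + q ^ (2 n + 1))\<close>. Up to a constant factor this is a Bailey pair relative to
  \<open>q\<^sup>2\<close>, in the base \<open>q\<^sup>2\<close>.
\<close>

lemma cubic_poch_Bailey_pair:
  fixes q w :: "'a::field"
  assumes q: "nonroot q" and w: "w * w + w + 1 = 0" "w \<noteq> 1"
  shows "cubic_poch q n * inverse (1 - q ^ (2 * n + 1)) * rfac (q ^ 2) (2 * n) =
    (\<Sum>r\<le>n. (- 1) ^ r * sgn3 r * (q ^ r\<^sup>2 + q ^ (Suc r)\<^sup>2) * rfac (q ^ 2) (n - r) * rfac (q ^ 2) (n + r + 1))"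
proof -
  have q2: "nonroot (q ^ 2)" using q by (simp add: nonroot_power)
  have nz: "1 - q ^ (2 * n + 1) \<noteq> 0" using q by (auto simp: nonroot_def)
  have "1 - (q ^ 2) ^ Suc (2 * n) = (1 - q ^ (2 * n + 1)) * (1 + q ^ (2 * n + 1))"
  proof -
    have "(q ^ 2) ^ Suc (2 * n) = q ^ ((2 * n + 1) + (2 * n + 1))"
      unfolding power_mult[symmetric] by (rule arg_cong[of _ _ "(^) q"]) simp
    then show ?thesis by (simp only: power_add[of q "2 * n + 1" "2 * n + 1"]) (simp add: algebra_simps)
  qed
  then have "rfac (q ^ 2) (2 * n) = (1 - q ^ (2 * n + 1)) * (1 + q ^ (2 * n + 1)) * rfac (q ^ 2) (2 * n + 1)"
    using rfac_Suc[OF q2, of "2 * n"] by simp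
  then have "cubic_poch q n * inverse (1 - q ^ (2 * n + 1)) * rfac (q ^ 2) (2 * n)
      = (1 + q ^ (2 * n + 1)) * cubic_poch q n * rfac (q ^ 2) (2 * n + 1)"
    using nz by simp
  also have "\<dots> = (\<Sum>r\<le>n. (- 1) ^ r * sgn3 r * (q ^ r\<^sup>2 + q ^ (Suc r)\<^sup>2)
      * (qbinom (q ^ 2) (2 * n + 1) (n - r) * rfac (q ^ 2) (2 * n + 1)))"
    unfolding cubic_poch_expansion[OF q2 w] by (simp only: sum_distrib_right mult.assoc)
  also have "\<dots> = (\<Sum>r\<le>n. (- 1) ^ r * sgn3 r * (q ^ r\<^sup>2 + q ^ (Suc r)\<^sup>2) * rfac (q ^ 2) (n - r) * rfac (q ^ 2) (n + r + 1))"
  proof (intro sum.cong refl)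
    fix r assume "r \<in> {..n}"
    then have e: "2 * n + 1 - (n - r) = n + r + 1" and le: "n - r \<le> 2 * n + 1" by auto
    have "qbinom (q ^ 2) (2 * n + 1) (n - r) * rfac (q ^ 2) (2 * n + 1) = rfac (q ^ 2) (n - r) * rfac (q ^ 2) (n + r + 1)"
      using qpoch_nonzero[OF q2, of "2 * n + 1"] le unfolding qbinom_def e
      by (simp add: rfac_def[of "q ^ 2" "Suc (2 * n)"])
    then show "(- 1) ^ r * sgn3 r * (q ^ r\<^sup>2 + q ^ (Suc r)\<^sup>2) * (qbinom (q\<^sup>2) (2 * n + 1) (n - r) * rfac (q\<^sup>2) (2 * n + 1)) =
         (- 1) ^ r * sgn3 r * (q ^ r\<^sup>2 + q ^ (Suc r)\<^sup>2) * rfac (q\<^sup>2) (n - r) * rfac (q\<^sup>2) (n + r + 1)"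
      by (simp only: mult.assoc)
  qed
  finally show ?thesis .
qed

text \<open>
  The kernel of Bailey's lemma: after the shift \<open>n = j + r\<close> this is \<open>finite_Durfee\<close> with
  \<open>c = 2 r + 1\<close>.
\<close>

lemma finite_Bailey_sum:
  assumes b: "nonroot b" and r: "r \<le> M"
  shows "(\<Sum>n\<in>{r..M}. b ^ (n * (n + 1)) * rfac b (M - n) * (rfac b (n - r) * rfac b (n + r + 1)))
     = b ^ (r * (r + 1)) * (rfac b (M - r) * rfac b (M + r + 1))"
proof -
  have "(\<Sum>n\<in>{r..M}. b ^ (n * (n + 1)) * rfac b (M - n) * (rfac b (n - r) * rfac b (n + r + 1)))
    = (\<Sum>j\<le>M - r. b ^ (r * (r + 1)) *
        (b ^ (j * (j + (2 * r + 1))) * rfac b j * rfac b (M - r - j) * rfac b (j + (2 * r + 1))))"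
  proof (rule sum.reindex_bij_witness[of _ "\<lambda>j. j + r" "\<lambda>n. n - r"], goal_cases)
    case (5 n)
    then obtain j where n: "n = j + r" by (metis atLeastAtMost_iff le_add_diff_inverse2)
    have "n * (n + 1) = r * (r + 1) + j * (j + (2 * r + 1))" by (simp add: n algebra_simps)
    moreover have "n - r = j" "n + r + 1 = j + (2 * r + 1)" "M - r - j = M - n" by (auto simp: n)
    ultimately show ?case by (simp only:) (simp only: power_add ac_simps)
  qed (use r in auto)
  also have "\<dots> = b ^ (r * (r + 1)) * (rfac b (M - r) * rfac b (M + r + 1))"
  proof -
    have "M - r + (2 * r + 1) = M + r + 1" using r by simp
    then show ?thesis by (simp only: sum_distrib_left[symmetric] finite_Durfee[OF b])
  qed
  finally show ?thesis .
qed

text \<open>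
  A finite version of Bailey's lemma for the pair \<open>cubic_poch_Bailey_pair\<close>: exchange the two
  summations and apply \<open>finite_Bailey_sum\<close> to the inner one. For large \<open>M\<close> the left-hand side approaches the generating function of
  the signed partitions divided by \<open>(q\<^sup>2; q\<^sup>2)\<^sub>\<infinity>\<close>, and the right-hand side a theta series divided by its square.
\<close>

lemma finite_Bailey_identity:
  fixes q w :: "'a::field"
  assumes q: "nonroot q" and w: "w * w + w + 1 = 0" "w \<noteq> 1"
  shows "(\<Sum>n\<le>M. q ^ (2 * n * (n + 1)) * cubic_poch q n * inverse (1 - q ^ (2 * n + 1)) * rfac (q ^ 2) (2 * n) * rfac (q ^ 2) (M - n))
    = (\<Sum>r\<le>M. (- 1) ^ r * sgn3 r * (q ^ (3 * r\<^sup>2 + 2 * r) + q ^ (3 * r\<^sup>2 + 4 * r + 1))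
        * (rfac (q ^ 2) (M - r) * rfac (q ^ 2) (M + r + 1)))" (is "?L = ?R")
proof -
  have q2: "nonroot (q ^ 2)" using q by (simp add: nonroot_power)
  define a where "a r = (- 1) ^ r * sgn3 r * (q ^ r\<^sup>2 + q ^ (Suc r)\<^sup>2)" for r
  have "?L = (\<Sum>n\<le>M. (\<Sum>r\<le>n. a r * ((q ^ 2) ^ (n * (n + 1)) * rfac (q ^ 2) (M - n)
      * (rfac (q ^ 2) (n - r) * rfac (q ^ 2) (n + r + 1)))))"
  proof (intro sum.cong refl)
    fix n
    have "q ^ (2 * n * (n + 1)) = (q ^ 2) ^ (n * (n + 1))" unfolding power_mult[symmetric] by (rule arg_cong[of _ _ "(^) q"]) simp
    then have "q ^ (2 * n * (n + 1)) * cubic_poch q n * inverse (1 - q ^ (2 * n + 1)) * rfac (q ^ 2) (2 * n) * rfac (q ^ 2) (M - n)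
       = (q ^ 2) ^ (n * (n + 1)) * rfac (q ^ 2) (M - n) *
         (cubic_poch q n * inverse (1 - q ^ (2 * n + 1)) * rfac (q ^ 2) (2 * n))"
      by (simp only: ac_simps)
    then show "q ^ (2 * n * (n + 1)) * cubic_poch q n * inverse (1 - q ^ (2 * n + 1)) * rfac (q ^ 2) (2 * n) * rfac (q ^ 2) (M - n)
       = (\<Sum>r\<le>n. a r * ((q ^ 2) ^ (n * (n + 1)) * rfac (q ^ 2) (M - n)
      * (rfac (q ^ 2) (n - r) * rfac (q ^ 2) (n + r + 1))))"
      unfolding cubic_poch_Bailey_pair[OF q w] a_def[symmetric] by (simp only: sum_distrib_left ac_simps)
  qed
  also have "\<dots> = (\<Sum>r\<le>M. \<Sum>n\<in>{r..M}. a r * ((q ^ 2) ^ (n * (n + 1)) * rfac (q ^ 2) (M - n)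
      * (rfac (q ^ 2) (n - r) * rfac (q ^ 2) (n + r + 1))))"
    unfolding sum.Sigma[OF finite_atMost ballI[OF finite_atMost]]
      sum.Sigma[OF finite_atMost ballI[OF finite_atLeastAtMost]]
    by (rule sum.reindex_bij_witness[of _ "\<lambda>(r, n). (n, r)" "\<lambda>(n, r). (r, n)"]) auto
  also have "\<dots> = (\<Sum>r\<le>M. a r * ((q ^ 2) ^ (r * (r + 1)) * (rfac (q ^ 2) (M - r) * rfac (q ^ 2) (M + r + 1))))"
    by (intro sum.cong refl) (simp only: sum_distrib_left[symmetric] finite_Bailey_sum[OF q2] atMost_iff)
  also have "\<dots> = ?R"
  proof (intro sum.cong refl)
    fix r
    have "(q ^ r\<^sup>2 + q ^ (Suc r)\<^sup>2) * (q ^ 2) ^ (r * (r + 1)) = q ^ (3 * r\<^sup>2 + 2 * r) + q ^ (3 * r\<^sup>2 + 4 * r + 1)"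
      unfolding distrib_right power_mult[symmetric] power_add[symmetric]
      by (rule arg_cong2[of _ _ _ _ "(+)"]; rule arg_cong[of _ _ "(^) q"]) (simp_all add: power2_eq_square)
    then have "a r * (q ^ 2) ^ (r * (r + 1)) = (- 1) ^ r * sgn3 r * (q ^ (3 * r\<^sup>2 + 2 * r) + q ^ (3 * r\<^sup>2 + 4 * r + 1))"
      unfolding a_def by (simp only: mult.assoc)
    then show "a r * ((q ^ 2) ^ (r * (r + 1)) * (rfac (q ^ 2) (M - r) * rfac (q ^ 2) (M + r + 1)))
      = (- 1) ^ r * sgn3 r * (q ^ (3 * r\<^sup>2 + 2 * r) + q ^ (3 * r\<^sup>2 + 4 * r + 1))
        * (rfac (q ^ 2) (M - r) * rfac (q ^ 2) (M + r + 1))"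
      by (simp only: mult.assoc[symmetric])
  qed
  finally show ?thesis .
qed

section \<open>A finite form of the quintuple product identity\<close>

text \<open>
  Creative telescoping: with \<open>f n k\<close> the summand, the explicit \<open>G\<close> in the proof satisfies
  \<open>(1 - z b ^ (n + 1)) f (n + 1) k - f n k = G (k + 1) - G k\<close>, and \<open>G\<close> vanishes at both ends.
\<close>

lemma quintuple_step:
  assumes b: "nonroot b" and nz: "\<And>i. i \<le> 2 * Suc n \<Longrightarrow> z ^ 2 * b ^ i \<noteq> 1"
  shows "(1 - z * b ^ Suc n) *
      (\<Sum>k\<le>Suc n. (1 + z * b ^ k) * qbinom b (Suc n) k * z ^ k * b ^ (k * k) / qpoch (z ^ 2 * b ^ k) b (Suc (Suc n)))
    = (\<Sum>k\<le>n. (1 + z * b ^ k) * qbinom b n k * z ^ k * b ^ (k * k) / qpoch (z ^ 2 * b ^ k) b (Suc n))"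
proof -
  define a where "a = b ^ Suc n"
  have a1: "1 - a \<noteq> 0" using b by (auto simp: a_def nonroot_def)
  define f where "f n k = (1 + z * b ^ k) * qbinom b n k * z ^ k * b ^ (k * k) / qpoch (z ^ 2 * b ^ k) b (Suc n)" for n k
  \<comment> \<open>The factor \<open>1 - b ^ k\<close> makes \<open>G 0\<close> vanish, the q-binomial coefficient makes \<open>G (n + 2)\<close> vanish.\<close>
  define G where "G k = - ((1 - b ^ k) * qbinom b (Suc n) k / (1 - a)) * z ^ k * b ^ (k * k + n + 1 - k)
      / qpoch (z ^ 2 * b ^ k) b (Suc n)" for k
  have step: "(1 - z * a) * f (Suc n) k - f n k = G (Suc k) - G k" if k: "k \<le> Suc n" for k
  proof -
    define K L where "K = b ^ k" and "L = b ^ (Suc n - k)"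
    have aKL: "a = K * L" using k by (simp add: a_def K_def L_def flip: power_add)
    define D where "D = qpoch (z ^ 2 * K) b (Suc (Suc n))"
    define B where "B = qbinom b (Suc n) k"
    \<comment> \<open>All four terms of the telescoping equation are polynomial multiples of \<open>T / (1 - a)\<close>.\<close>
    define T where "T = B * (z ^ k * b ^ (k * k)) / D"
    have "D \<noteq> 0"
    proof -
      have "z ^ 2 * K * b ^ i \<noteq> 1" if "i < Suc (Suc n)" for i
        using nz[of "k + i"] k that by (simp add: K_def mult.assoc power_add)
      then show ?thesis unfolding D_def qpoch_def by (auto simp del: prod.lessThan_Suc)
    qed
    have D1: "D = (1 - z ^ 2 * K * a) * qpoch (z ^ 2 * K) b (Suc n)"
      unfolding D_def a_def by (rule qpoch_Suc)
    have D2: "D = (1 - z ^ 2 * K) * qpoch (z ^ 2 * b ^ Suc k) b (Suc n)"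
      unfolding D_def by (subst qpoch_Suc_left) (simp add: K_def mult_ac)
    have B1: "(1 - a) * qbinom b n k = (1 - L) * B"
    proof (cases "k = Suc n")
      case True
      then show ?thesis by (simp add: L_def qbinom_def)
    next
      case False
      then have le: "k \<le> n" using k by simp
      show ?thesis
        using rfac_Suc[OF b, of "n - k"] le
        by (simp add: B_def qbinom_def L_def a_def Suc_diff_le qpoch_Suc)
    qed
    have B2: "(1 - b ^ Suc k) * qbinom b (Suc n) (Suc k) = (1 - L) * B"
    proof (cases "k = Suc n")
      case True
      then show ?thesis by (simp add: L_def qbinom_def)
    next
      case False
      then have le: "k \<le> n" using k by simp
      show ?thesis
        using le by (simp add: B_def qbinom_def L_def Suc_diff_le
          rfac_Suc[OF b, of "n - k", symmetric] rfac_Suc[OF b, of k, symmetric])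
    qed
    have f1: "f (Suc n) k = (1 + z * K) * T"
      by (simp add: f_def T_def B_def D_def K_def)
    have f2: "f n k = (1 - L) * (1 + z * K) * (1 - z ^ 2 * K * a) * T / (1 - a)"
    proof -
      have "qbinom b n k = (1 - L) * B / (1 - a)" using B1 a1 by (simp add: field_simps)
      moreover have "1 / qpoch (z ^ 2 * K) b (Suc n) = (1 - z ^ 2 * K * a) / D"
        using D1 \<open>D \<noteq> 0\<close> by auto
      ultimately show ?thesis
        unfolding f_def T_def K_def[symmetric] by (simp add: divide_inverse mult_ac)
    qed
    have G1: "G (Suc k) = - ((1 - L) * z * K * a * (1 - z ^ 2 * K) * T / (1 - a))"
    proof -
      have "1 / qpoch (z ^ 2 * b ^ Suc k) b (Suc n) = (1 - z ^ 2 * K) / D"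
        using D2 \<open>D \<noteq> 0\<close> by auto
      moreover have "b ^ (Suc k * Suc k + n + 1 - Suc k) = b ^ (k * k) * K * a"
      proof -
        have "Suc k * Suc k + n + 1 - Suc k = k * k + k + Suc n" by simp
        then show ?thesis by (simp only: power_add K_def a_def)
      qed
      ultimately show ?thesis
        unfolding G_def B2 T_def by (simp add: divide_inverse mult_ac)
    qed
    have G0: "G k = - ((1 - K) * L * (1 - z ^ 2 * K * a) * T / (1 - a))"
    proof -
      have "1 / qpoch (z ^ 2 * K) b (Suc n) = (1 - z ^ 2 * K * a) / D"
        using D1 \<open>D \<noteq> 0\<close> by auto
      moreover have "b ^ (k * k + n + 1 - k) = b ^ (k * k) * L"
        using k by (simp add: L_def flip: power_add)
      ultimately show ?thesis
        unfolding G_def T_def K_def[symmetric] B_def[symmetric] by (simp add: divide_inverse mult_ac)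
    qed
    have "((1 - z * a) * f (Suc n) k - f n k) * (1 - a) = (G (Suc k) - G k) * (1 - a)"
      unfolding f1 f2 G1 G0 using a1 unfolding left_diff_distrib
      by simp (simp add: aKL algebra_simps power2_eq_square)
    then show ?thesis using a1 by simp
  qed
  have "(\<Sum>k\<le>Suc n. (1 - z * a) * f (Suc n) k - f n k) = (\<Sum>k\<le>Suc n. G (Suc k) - G k)"
    using step by simp
  also have "\<dots> = G (Suc (Suc n)) - G 0"
    using sum_telescope[of "\<lambda>k. - G k" "Suc n"] by (simp add: algebra_simps)
  also have "\<dots> = 0" by (simp add: G_def qbinom_def)
  finally have "(1 - z * a) * (\<Sum>k\<le>Suc n. f (Suc n) k) = (\<Sum>k\<le>Suc n. f n k)"
    by (simp only: sum_subtractf sum_distrib_left[symmetric] right_minus_eq)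
  also have "(\<Sum>k\<le>Suc n. f n k) = (\<Sum>k\<le>n. f n k)" by (simp add: f_def qbinom_def)
  finally show ?thesis by (simp only: f_def a_def)
qed

text \<open>
  A one-sided finite form of the quintuple product identity, due to Chen, Chu and Gu.
  The number of terms is free, so substituting \<open>z b ^ (- m)\<close> for \<open>z\<close> and \<open>2 m\<close> for \<open>n\<close> gives the
  two-sided sum that is needed.
\<close>

lemma finite_quintuple_product:
  assumes b: "nonroot b" and nz: "\<And>i. i \<le> 2 * n \<Longrightarrow> z ^ 2 * b ^ i \<noteq> 1"
  shows "(\<Sum>k\<le>n. (1 + z * b ^ k) * qbinom b n k * z ^ k * b ^ (k * k) / qpoch (z ^ 2 * b ^ k) b (Suc n))
    = 1 / qpoch z b (Suc n)"
  using nz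
proof (induction n)
  case 0
  have "1 - z ^ 2 = (1 - z) * (1 + z)" by (simp add: algebra_simps power2_eq_square)
  then show ?case using 0[of 0] b by (auto simp: qpoch_Suc)
next
  case (Suc n)
  have "z * b ^ Suc n \<noteq> 1"
  proof
    assume "z * b ^ Suc n = 1"
    then have "(z * b ^ Suc n) ^ 2 = 1" by simp
    then show False using Suc.prems[of "2 * Suc n"] by (simp only: power_mult_distrib power_mult[symmetric] mult.commute) simp
  qed
  moreover have "(1 - z * b ^ Suc n) * (\<Sum>k\<le>Suc n. (1 + z * b ^ k) * qbinom b (Suc n) k * z ^ k * b ^ (k * k)
      / qpoch (z ^ 2 * b ^ k) b (Suc (Suc n))) = 1 / qpoch z b (Suc n)"
    by (rule trans[OF quintuple_step[OF b] Suc.IH]) (use Suc.prems in auto)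
  ultimately show ?case
    unfolding qpoch_Suc[of z b "Suc n"] by (auto simp: divide_simps mult_ac simp del: sum.atMost_Suc power_Suc)
qed

text \<open>
  Inverting the factors with negative exponents, \<open>1 - u ^ (- 1) = - u ^ (- 1) (1 - u)\<close>, turns a shifted factorial that
  starts at a negative power into one with nonnegative exponents, at the price of a sign and a power of \<open>q\<close>.
\<close>

lemma qpoch_reflect:
  fixes q :: "'a::field"
  assumes q: "q \<noteq> 0"
  shows "qpoch (q powi (e - 18 * int d)) (q ^ 18) (d + l) =
    (- 1) ^ d * q powi (e * int d - 9 * int d * (int d + 1)) *
    (qpoch (q powi (18 - e)) (q ^ 18) d * qpoch (q powi e) (q ^ 18) l)"
proof (induction d)
  case 0
  show ?case by simp
next
  case (Suc d)
  have p: "q ^ 18 = q powi 18" by simp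
  have pd: "(q ^ 18) ^ d = q powi (18 * int d)"
    using power_int_of_nat[of q "18 * d"] by (simp add: power_mult)
  define u where "u = q powi (18 * (int d + 1) - e)"
  define v where "v = q powi (e - 18 * (int d + 1))"
  have uv: "u * v = 1" using q by (simp add: u_def v_def flip: power_int_add)
  have "qpoch (q powi (e - 18 * int (Suc d))) (q ^ 18) (Suc d + l)
      = (1 - v) * qpoch (q powi (e - 18 * int d)) (q ^ 18) (d + l)"
  proof -
    have "q powi (e - 18 * int (Suc d)) * q ^ 18 = q powi (e - 18 * int d)"
      using q unfolding p by (simp flip: power_int_add add: algebra_simps del: power_int_numeral)
    moreover have "q powi (e - 18 * int (Suc d)) = v" by (simp add: v_def add.commute)
    ultimately show ?thesis by (simp add: qpoch_Suc_left)
  qed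
  moreover have "1 - v = - v * (1 - u)" using uv by (simp add: algebra_simps)
  moreover have "qpoch (q powi (18 - e)) (q ^ 18) (Suc d) = (1 - u) * qpoch (q powi (18 - e)) (q ^ 18) d"
  proof -
    have "q powi (18 - e) * (q ^ 18) ^ d = u"
      using q unfolding pd by (simp add: u_def algebra_simps flip: power_int_add)
    then show ?thesis by (simp only: qpoch_Suc)
  qed
  moreover have "q powi (e * int (Suc d) - 9 * int (Suc d) * (int (Suc d) + 1))
      = v * q powi (e * int d - 9 * int d * (int d + 1))"
    using q by (simp add: v_def algebra_simps flip: power_int_add)
  ultimately show ?case unfolding Suc.IH by (simp add: mult_ac)
qed

text \<open>
  The case \<open>b = q ^ 18\<close>, \<open>z = q ^ (1 - 18 m)\<close> of \<open>finite_quintuple_product\<close>, with all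
  negative powers cleared by \<open>qpoch_reflect\<close>. The remaining power in the term of index \<open>j = k - m\<close> is
  \<open>27 j\<^sup>2 - 6 j\<close>, independent of \<open>m\<close>, and the factor \<open>1 + z b ^ k\<close> splits it into two.
\<close>

lemma finite_bilateral_quintuple:
  fixes q :: "'a::field"
  assumes q: "nonroot q"
  defines "p \<equiv> q ^ 18"
  shows "(\<Sum>k\<le>2 * m. (- 1) ^ (k + m) *
      (q ^ nat (27 * (int k - int m)\<^sup>2 - 6 * (int k - int m)) + q ^ nat (27 * (int k - int m)\<^sup>2 + 12 * (int k - int m) + 1)) *
      (rfac p k * rfac p (2 * m - k) * inverse (qpoch (q ^ 16) p (2 * m - k)) * inverse (qpoch (q ^ 2) p (k + 1))))
    = rfac p (2 * m) * inverse (qpoch (q ^ 17) p m) * inverse (qpoch q p (m + 1))"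
proof -
  have q0: "q \<noteq> 0" using q by (simp add: nonroot_def)
  have p: "nonroot p" using q by (simp add: p_def nonroot_power)
  have pk: "p ^ k = q powi (18 * int k)" for k
    using power_int_of_nat[of q "18 * k"] by (simp add: p_def power_mult)
  have powi1: "q powi e \<noteq> 1" if "e \<noteq> 0" for e
  proof (cases "e > 0")
    case True
    then show ?thesis using q by (simp add: power_int_def nonroot_def)
  next
    case False
    then show ?thesis using q that by (simp add: power_int_def nonroot_def power_inverse)
  qed
  define z where "z = q powi (1 - 18 * int m)"
  have z2: "z ^ 2 = q powi (2 - 36 * int m)"
    using q0 by (simp add: z_def power2_eq_square flip: power_int_add)
  have "z ^ 2 * p ^ i \<noteq> 1" for i
  proof -
    \<comment> \<open>The exponent is 2 modulo 18.\<close>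
    have "2 - 36 * int m + 18 * int i \<noteq> 0" by presburger
    then show ?thesis using powi1 q0 by (simp add: z2 pk flip: power_int_add)
  qed
  then have main: "(\<Sum>k\<le>2 * m. (1 + z * p ^ k) * qbinom p (2 * m) k * z ^ k * p ^ (k * k)
      / qpoch (z ^ 2 * p ^ k) p (Suc (2 * m))) = 1 / qpoch z p (Suc (2 * m))"
    by (intro finite_quintuple_product[OF p])
  \<comment> \<open>The prefactor produced by reflecting the right-hand side.\<close>
  define c where "c = (- 1) ^ m * q powi (int m - 9 * int m * (int m + 1))"
  have c: "c \<noteq> 0" using q0 by (simp add: c_def)
  have rhs: "1 / qpoch z p (Suc (2 * m)) = inverse c * (inverse (qpoch (q ^ 17) p m) * inverse (qpoch q p (m + 1)))"
    using qpoch_reflect[OF q0, of 1 m "m + 1"]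
    by (simp add: z_def p_def c_def mult_2 divide_inverse)
  have summand: "c * ((1 + z * p ^ k) * qbinom p (2 * m) k * z ^ k * p ^ (k * k) / qpoch (z ^ 2 * p ^ k) p (Suc (2 * m)))
      = qpoch p p (2 * m) * ((- 1) ^ (k + m) *
      (q ^ nat (27 * (int k - int m)\<^sup>2 - 6 * (int k - int m)) + q ^ nat (27 * (int k - int m)\<^sup>2 + 12 * (int k - int m) + 1)) *
      (rfac p k * rfac p (2 * m - k) * inverse (qpoch (q ^ 16) p (2 * m - k)) * inverse (qpoch (q ^ 2) p (k + 1))))"
    if k: "k \<le> 2 * m" for k
  proof -
    define j where "j = int k - int m"
    define d where "d = 2 * m - k"
    have d: "int d = int m - j" using k by (simp add: d_def j_def of_nat_diff)
    have kj: "int k = int m + j" by (simp add: j_def)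
    define E where "E = 2 * int d - 9 * int d * (int d + 1)"
    have "z ^ 2 * p ^ k = q powi (2 - 18 * int d)"
      using q0 by (simp add: z2 pk d kj algebra_simps flip: power_int_add)
    moreover have "Suc (2 * m) = d + (k + 1)" using k by (simp add: d_def)
    ultimately have "qpoch (z ^ 2 * p ^ k) p (Suc (2 * m))
        = (- 1) ^ d * q powi E * (qpoch (q ^ 16) p d * qpoch (q ^ 2) p (k + 1))"
      using qpoch_reflect[OF q0, of 2 d "k + 1"] by (simp add: p_def E_def)
    moreover have "inverse ((- 1 :: 'a) ^ d) = (- 1) ^ d" by (simp flip: power_inverse)
    ultimately have den: "inverse (qpoch (z ^ 2 * p ^ k) p (Suc (2 * m)))
        = (- 1) ^ d * q powi (- E) * (inverse (qpoch (q ^ 16) p d) * inverse (qpoch (q ^ 2) p (k + 1)))"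
      by (simp only: power_int_minus inverse_mult_distrib)
    have sgn: "(- 1 :: 'a) ^ m * (- 1) ^ d = (- 1) ^ (k + m)"
    proof -
      have "m + d + 2 * k = (k + m) + 2 * m" using k by (simp add: d_def)
      then have "(- 1 :: 'a) ^ (m + d + 2 * k) = (- 1) ^ ((k + m) + 2 * m)" by (rule arg_cong)
      then show ?thesis by (simp add: power_add power_mult)
    qed
    have zk: "z ^ k = q powi ((1 - 18 * int m) * int k)"
      by (simp only: z_def power_int_mult power_int_of_nat)
    have n1: "27 * j\<^sup>2 - 6 * j \<ge> 0" and n2: "27 * j\<^sup>2 + 12 * j + 1 \<ge> 0"
    proof -
      have "\<bar>j\<bar> \<le> j\<^sup>2" using self_le_power[of "\<bar>j\<bar>" 2] by (cases "j = 0") auto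
      then show "27 * j\<^sup>2 - 6 * j \<ge> 0" "27 * j\<^sup>2 + 12 * j + 1 \<ge> 0" by linarith+
    qed
    have nat1: "q ^ nat (27 * j\<^sup>2 - 6 * j) = q powi (27 * j\<^sup>2 - 6 * j)"
      using n1 by (simp add: power_int_def)
    have nat2: "q ^ nat (27 * j\<^sup>2 + 12 * j + 1) = q powi (27 * j\<^sup>2 + 12 * j + 1)"
      using n2 by (simp add: power_int_def)
    have expo: "q powi (int m - 9 * int m * (int m + 1)) * (q powi ((1 - 18 * int m) * int k) * (p ^ (k * k) * q powi (- E)))
        = q powi (27 * j\<^sup>2 - 6 * j)"
      using q0 unfolding pk E_def
      by (simp add: d kj power2_eq_square flip: power_int_add) (simp add: algebra_simps)
    have fac: "(1 + z * p ^ k) * q powi (27 * j\<^sup>2 - 6 * j)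
        = q powi (27 * j\<^sup>2 - 6 * j) + q powi (27 * j\<^sup>2 + 12 * j + 1)"
      using q0 by (simp add: z_def pk kj distrib_right flip: power_int_add) (simp add: algebra_simps)
    have "c * ((1 + z * p ^ k) * qbinom p (2 * m) k * z ^ k * p ^ (k * k) / qpoch (z ^ 2 * p ^ k) p (Suc (2 * m)))
      = ((- 1) ^ m * (- 1) ^ d) * qbinom p (2 * m) k *
        ((1 + z * p ^ k) * (q powi (int m - 9 * int m * (int m + 1)) * (z ^ k * (p ^ (k * k) * q powi (- E))))) *
         (inverse (qpoch (q ^ 16) p d) * inverse (qpoch (q ^ 2) p (k + 1)))"
      unfolding divide_inverse den c_def by (simp only: mult_ac)
    also have "\<dots> = (- 1) ^ (k + m) * qbinom p (2 * m) k *
        (q powi (27 * j\<^sup>2 - 6 * j) + q powi (27 * j\<^sup>2 + 12 * j + 1)) *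
         (inverse (qpoch (q ^ 16) p d) * inverse (qpoch (q ^ 2) p (k + 1)))"
      unfolding zk expo sgn fac ..
    finally show ?thesis
      using k by (simp only: qbinom_def if_True nat1 nat2 j_def[symmetric] d_def[symmetric]) (simp only: mult_ac)
  qed
  have "qpoch p p (2 * m) * (\<Sum>k\<le>2 * m. (- 1) ^ (k + m) *
      (q ^ nat (27 * (int k - int m)\<^sup>2 - 6 * (int k - int m)) + q ^ nat (27 * (int k - int m)\<^sup>2 + 12 * (int k - int m) + 1)) *
      (rfac p k * rfac p (2 * m - k) * inverse (qpoch (q ^ 16) p (2 * m - k)) * inverse (qpoch (q ^ 2) p (k + 1))))
    = c * (1 / qpoch z p (Suc (2 * m)))"
    unfolding main[symmetric] sum_distrib_left by (intro sum.cong refl) (simp only: summand atMost_iff)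
  also have "\<dots> = inverse (qpoch (q ^ 17) p m) * inverse (qpoch q p (m + 1))"
    unfolding rhs using c by simp
  finally have "rfac p (2 * m) * (qpoch p p (2 * m) * (\<Sum>k\<le>2 * m. (- 1) ^ (k + m) *
      (q ^ nat (27 * (int k - int m)\<^sup>2 - 6 * (int k - int m)) + q ^ nat (27 * (int k - int m)\<^sup>2 + 12 * (int k - int m) + 1)) *
      (rfac p k * rfac p (2 * m - k) * inverse (qpoch (q ^ 16) p (2 * m - k)) * inverse (qpoch (q ^ 2) p (k + 1)))))
    = rfac p (2 * m) * (inverse (qpoch (q ^ 17) p m) * inverse (qpoch q p (m + 1)))"
    by (rule arg_cong)
  moreover have "rfac p (2 * m) * qpoch p p (2 * m) = 1"
    using qpoch_nonzero[OF p, of "2 * m"] by (simp add: rfac_def)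
  ultimately show ?thesis
    by (simp only: mult.assoc[symmetric] mult_1_left)
qed

section \<open>The two theta sums agree\<close>

text \<open>
  The left sum is the theta side of \<open>finite_Bailey_identity\<close>, the right one that of
  \<open>finite_bilateral_quintuple\<close>. Raising \<open>m\<close> by one adds the indices \<open>3 m + 2\<close> and \<open>3 m + 3\<close> on the left (the terms with \<open>r\<close> of
  residue 1 modulo 3 vanish), and \<open>j = m + 1\<close> and \<open>j = - m - 1\<close> on the right; the four new exponents agree.
\<close>

lemma theta_rearrangement:
  fixes q :: "'a::comm_ring_1"
  shows "(\<Sum>r\<le>3 * m. (- 1) ^ r * sgn3 r * (q ^ (3 * r\<^sup>2 + 2 * r) + q ^ (3 * r\<^sup>2 + 4 * r + 1)))
    = (\<Sum>k\<le>2 * m. (- 1) ^ (k + m) *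
      (q ^ nat (27 * (int k - int m)\<^sup>2 - 6 * (int k - int m)) + q ^ nat (27 * (int k - int m)\<^sup>2 + 12 * (int k - int m) + 1)))"
proof (induction m)
  case 0
  show ?case by (simp add: sgn3_def)
next
  case (Suc m)
  define t where "t j = q ^ nat (27 * j\<^sup>2 - 6 * j) + q ^ nat (27 * j\<^sup>2 + 12 * j + 1)" for j :: int
  define s where "s r = sgn3 r * (q ^ (3 * r\<^sup>2 + 2 * r) + q ^ (3 * r\<^sup>2 + 4 * r + 1))" for r
  have IH: "(\<Sum>r\<le>3 * m. (- 1) ^ r * s r) = (\<Sum>k\<le>2 * m. (- 1) ^ (k + m) * t (int k - int m))"
    using Suc.IH by (simp only: s_def t_def mult.assoc)
  have s1: "s (3 * m + 1) = 0" by (simp add: s_def sgn3_def)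
  have s23: "s (3 * m + 3) - s (3 * m + 2) = t (int m + 1) + t (- int m - 1)"
  proof -
    have g: "sgn3 (3 * m + 3) = (1::'a)" "sgn3 (3 * m + 2) = (- 1 :: 'a)"
    proof -
      have "(3 * m + 3) mod 3 = 0" "(3 * m + 2) mod 3 = 2" by presburger+
      then show "sgn3 (3 * m + 3) = (1::'a)" "sgn3 (3 * m + 2) = (- 1 :: 'a)" by (simp_all add: sgn3_def)
    qed
    have nat_eqI: "nat x = y" if "x = int y" for x y using that by simp
    have e: "nat (27 * (int m + 1)\<^sup>2 - 6 * (int m + 1)) = 3 * (3 * m + 2)\<^sup>2 + 4 * (3 * m + 2) + 1"
      "nat (27 * (int m + 1)\<^sup>2 + 12 * (int m + 1) + 1) = 3 * (3 * m + 3)\<^sup>2 + 4 * (3 * m + 3) + 1"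
      "nat (27 * (- int m - 1)\<^sup>2 - 6 * (- int m - 1)) = 3 * (3 * m + 3)\<^sup>2 + 2 * (3 * m + 3)"
      "nat (27 * (- int m - 1)\<^sup>2 + 12 * (- int m - 1) + 1) = 3 * (3 * m + 2)\<^sup>2 + 2 * (3 * m + 2)"
      by (rule nat_eqI, simp add: power2_eq_square algebra_simps)+
    show ?thesis unfolding s_def t_def g e by simp
  qed
  have "(\<Sum>r\<le>3 * Suc m. (- 1) ^ r * s r)
      = (\<Sum>r\<le>3 * m. (- 1) ^ r * s r) + (- 1) ^ (3 * m + 1) * s (3 * m + 1)
        + (- 1) ^ (3 * m + 2) * s (3 * m + 2) + (- 1) ^ (3 * m + 3) * s (3 * m + 3)"
  proof -
    have "3 * Suc m = Suc (Suc (Suc (3 * m)))" by simp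
    then show ?thesis by (simp only: sum.atMost_Suc) (simp only: numeral_3_eq_3 numeral_2_eq_2 add_Suc_right add_0_right One_nat_def)
  qed
  also have "\<dots> = (\<Sum>r\<le>3 * m. (- 1) ^ r * s r) - (- 1) ^ m * (s (3 * m + 3) - s (3 * m + 2))"
  proof -
    have "(- 1 :: 'a) ^ (3 * m) = (- 1) ^ m" by (simp add: power_mult)
    then show ?thesis unfolding s1 power_add by (simp add: algebra_simps)
  qed
  also have "\<dots> = (\<Sum>k\<le>2 * m. (- 1) ^ (k + m) * t (int k - int m)) - (- 1) ^ m * (t (int m + 1) + t (- int m - 1))"
    unfolding s23 IH ..
  also have "\<dots> = (\<Sum>k\<le>2 * Suc m. (- 1) ^ (k + Suc m) * t (int k - int (Suc m)))"
  proof -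
    have "(\<Sum>k\<le>2 * Suc m. (- 1) ^ (k + Suc m) * t (int k - int (Suc m)))
      = (- 1) ^ Suc m * t (0 - int (Suc m)) + (\<Sum>k\<le>2 * m. (- 1) ^ (Suc k + Suc m) * t (int (Suc k) - int (Suc m)))
        + (- 1) ^ (Suc (Suc (2 * m)) + Suc m) * t (int (Suc (Suc (2 * m))) - int (Suc m))"
    proof -
      have "2 * Suc m = Suc (Suc (2 * m))" by simp
      then show ?thesis
        by (simp only: sum.atMost_Suc_shift[of _ "Suc (2 * m)"] sum.atMost_Suc[of _ "2 * m"] of_nat_0 add_0) (simp only: add.assoc)
    qed
    also have "(\<Sum>k\<le>2 * m. (- 1) ^ (Suc k + Suc m) * t (int (Suc k) - int (Suc m)))
        = (\<Sum>k\<le>2 * m. (- 1) ^ (k + m) * t (int k - int m))" by simp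
    also have "0 - int (Suc m) = - int m - 1" by simp
    also have "int (Suc (Suc (2 * m))) - int (Suc m) = int m + 1" by simp
    also have "(- 1 :: 'a) ^ (Suc (Suc (2 * m)) + Suc m) = - ((- 1) ^ m)" by (simp add: power_add power_mult)
    finally show ?thesis by (simp add: algebra_simps)
  qed
  finally show ?case by (simp only: s_def t_def mult.assoc)
qed

section \<open>Passage to formal power series\<close>

lemma fps_to_fls_sum: "fps_to_fls (\<Sum>i\<in>I. f i) = (\<Sum>i\<in>I. fps_to_fls (f i))"
  by (induction I rule: infinite_finite_induct) auto

lemma fps_to_fls_prod: "fps_to_fls (\<Prod>i\<in>I. f i) = (\<Prod>i\<in>I. fps_to_fls (f i :: 'a::comm_ring_1 fps))"
  by (induction I rule: infinite_finite_induct) (auto simp: fls_times_fps_to_fls)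

lemma fps_to_fls_qpoch: "fps_to_fls (qpoch a b n) = qpoch (fps_to_fls a) (fps_to_fls b) n"
  by (simp add: qpoch_def fps_to_fls_prod fls_times_fps_to_fls fps_to_fls_power)

lemma fps_to_fls_cubic_poch: "fps_to_fls (cubic_poch a n) = cubic_poch (fps_to_fls a) n"
  by (simp add: cubic_poch_def fps_to_fls_prod fps_to_fls_power fls_times_fps_to_fls)

lemma fps_to_fls_sgn3: "fps_to_fls (sgn3 r) = sgn3 r"
  by (simp add: sgn3_def)

lemma qpoch_X_nth_0: "a > 0 \<Longrightarrow> qpoch (fps_X ^ a) (fps_X ^ b) n $ 0 = (1 :: 'a::field)"
  by (induction n) (simp_all add: qpoch_Suc)

lemma fps_to_fls_inverse: "f $ 0 \<noteq> 0 \<Longrightarrow> fps_to_fls (inverse f) = inverse (fps_to_fls (f :: 'a::field fps))"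
  by (simp add: fls_inverse_fps_to_fls subdegree_eq_0_iff)

lemma fps_to_fls_inverse_qpoch:
  "a > 0 \<Longrightarrow> fps_to_fls (inverse (qpoch (fps_X ^ a) (fps_X ^ b) n)) = inverse (qpoch (fls_X ^ a) (fls_X ^ b) n :: 'a::field fls)"
  by (simp add: fps_to_fls_inverse qpoch_X_nth_0 fps_to_fls_qpoch fps_to_fls_power)

lemma nonroot_fls_X: "nonroot (fls_X :: 'a::field fls)"
proof -
  have "fls_X ^ n \<noteq> (1 :: 'a fls)" if "n > 0" for n
  proof
    assume "fls_X ^ n = (1 :: 'a fls)"
    then have "fps_to_fls (fps_X ^ n) = fps_to_fls (1 :: 'a fps)" by (simp add: fps_to_fls_power)
    then have "fps_X ^ n = (1 :: 'a fps)" by (simp only: fps_to_fls_eq_iff)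
    then have "fps_X ^ n $ 0 = (1 :: 'a fps) $ 0" by (rule arg_cong)
    then show False using that by (simp add: fps_X_power_nth)
  qed
  then show ?thesis by (simp add: nonroot_def)
qed

text \<open>
  The identity of \<open>finite_Bailey_identity\<close> holds in the field of Laurent series over the complex
  numbers, which contain the required root of unity. Both sides are images of power series, and the embedding is injective.
\<close>

lemma finite_Bailey_identity_fps:
  "(\<Sum>n\<le>M. fps_X ^ (2 * n * (n + 1)) * cubic_poch fps_X n * inverse (1 - fps_X ^ (2 * n + 1)) * rfac (fps_X ^ 2) (2 * n) * rfac (fps_X ^ 2) (M - n))
    = (\<Sum>r\<le>M. (- 1) ^ r * sgn3 r * (fps_X ^ (3 * r\<^sup>2 + 2 * r) + fps_X ^ (3 * r\<^sup>2 + 4 * r + 1))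
        * (rfac (fps_X ^ 2) (M - r) * rfac (fps_X ^ 2) (M + r + 1)) :: complex fps)" (is "?L = ?R")
proof -
  define w where "w = Complex (- 1 / 2) (sqrt 3 / 2)"
  have "w * w + w + 1 = 0" by (simp add: w_def complex_eq_iff algebra_simps)
  then have "fls_const w * fls_const w + fls_const w + 1 = (0 :: complex fls)"
    by (simp add: fls_const_mult_const fls_plus_const flip: fls_const_1)
  moreover have "fls_const w \<noteq> (1 :: complex fls)"
    by (simp add: w_def complex_eq_iff)
  moreover have "fps_to_fls (inverse (1 - fps_X ^ (2 * n + 1))) = (inverse (1 - fls_X ^ (2 * n + 1)) :: complex fls)" for n
    by (subst fps_to_fls_inverse) (simp_all add: fps_to_fls_power fls_times_fps_to_fls)
  ultimately have "fps_to_fls ?L = fps_to_fls ?R"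
    using finite_Bailey_identity[OF nonroot_fls_X, of "fls_const w" M]
    by (simp only: fps_to_fls_sum fls_times_fps_to_fls rfac_def fps_to_fls_inverse_qpoch zero_less_numeral
       simp_thms fps_to_fls_cubic_poch fps_to_fls_sgn3 fps_to_fls_power fps_X_to_fls fps_to_fls_plus fps_to_fls_uminus fps_one_to_fls)
  then show ?thesis by (simp only: fps_to_fls_eq_iff)
qed

lemma bilateral_quintuple_fps:
  "(\<Sum>k\<le>2 * m. (- 1) ^ (k + m) *
      (fps_X ^ nat (27 * (int k - int m)\<^sup>2 - 6 * (int k - int m)) + fps_X ^ nat (27 * (int k - int m)\<^sup>2 + 12 * (int k - int m) + 1)) *
      (inverse (qpoch (fps_X ^ 18) (fps_X ^ 18) k) * inverse (qpoch (fps_X ^ 18) (fps_X ^ 18) (2 * m - k)) *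
       inverse (qpoch (fps_X ^ 16) (fps_X ^ 18) (2 * m - k)) * inverse (qpoch (fps_X ^ 2) (fps_X ^ 18) (k + 1))))
    = (inverse (qpoch (fps_X ^ 18) (fps_X ^ 18) (2 * m)) * inverse (qpoch (fps_X ^ 17) (fps_X ^ 18) m)
       * inverse (qpoch (fps_X ^ 1) (fps_X ^ 18) (m + 1)) :: complex fps)" (is "?L = ?R")
proof -
  have "fps_to_fls ?L = fps_to_fls ?R"
    using finite_bilateral_quintuple[OF nonroot_fls_X, of m]
    by (simp only: fps_to_fls_sum fls_times_fps_to_fls rfac_def fps_to_fls_inverse_qpoch zero_less_numeral zero_less_one
       fps_to_fls_power fps_X_to_fls fps_to_fls_plus fps_to_fls_uminus fps_one_to_fls power_one_right
       fps_to_fls_inverse_qpoch[of 1, unfolded power_one_right])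
  then show ?thesis by (simp only: fps_to_fls_eq_iff)
qed

section \<open>Passage to the limit\<close>

text \<open>
  Congruence modulo \<open>X ^ N\<close>. Infinite sums and products are avoided by working with finite ones that are
  correct up to a prescribed order.
\<close>

definition cong_upto :: "nat \<Rightarrow> 'a::zero fps \<Rightarrow> 'a fps \<Rightarrow> bool" where
  "cong_upto N f g \<longleftrightarrow> (\<forall>i<N. f $ i = g $ i)"

lemma cong_upto_refl [simp]: "cong_upto N f f"
  by (simp add: cong_upto_def)

lemma cong_upto_sym: "cong_upto N f g \<Longrightarrow> cong_upto N g f"
  by (simp add: cong_upto_def)

lemma cong_upto_trans [trans]: "cong_upto N f g \<Longrightarrow> cong_upto N g h \<Longrightarrow> cong_upto N f h"
  by (simp add: cong_upto_def)

lemma cong_upto_mult: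
  "cong_upto N f f' \<Longrightarrow> cong_upto N g g' \<Longrightarrow> cong_upto N (f * g) (f' * g' :: 'a::comm_ring_1 fps)"
  by (auto simp: cong_upto_def fps_mult_nth intro!: sum.cong)

lemma cong_upto_sum:
  "(\<And>i. i \<in> I \<Longrightarrow> cong_upto N (f i) (g i)) \<Longrightarrow> cong_upto N (\<Sum>i\<in>I. f i) (\<Sum>i\<in>I. g i :: 'a::comm_ring_1 fps)"
  by (auto simp: cong_upto_def fps_sum_nth intro!: sum.cong)

lemma cong_upto_inverse:
  fixes f g :: "'a::field fps"
  assumes "cong_upto N f g" "f $ 0 \<noteq> 0" "g $ 0 \<noteq> 0"
  shows "cong_upto N (inverse f) (inverse g)"
proof -
  have "cong_upto N (inverse f * inverse g * g) (inverse f * inverse g * f)"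
    using assms(1) by (intro cong_upto_mult cong_upto_refl) (rule cong_upto_sym)
  moreover have "inverse f * inverse g * g = inverse f" "inverse f * inverse g * f = inverse g"
    using assms(2,3) inverse_mult_eq_1[of f] inverse_mult_eq_1[of g]
    by (simp_all add: mult.assoc mult.left_commute)
  ultimately show ?thesis by simp
qed

lemma cong_upto_X_power_mult:
  "e \<ge> N \<Longrightarrow> cong_upto N (fps_X ^ e * f) (0 :: 'a::comm_ring_1 fps)"
  by (simp add: cong_upto_def fps_X_power_mult_nth)

lemma cong_upto_qpoch:
  assumes "b > 0" "N \<le> n"
  shows "cong_upto N (qpoch (fps_X ^ a) (fps_X ^ b) n) (qpoch (fps_X ^ a) (fps_X ^ b) N :: 'a::field fps)"
  using assms(2)
proof (induction n rule: dec_induct)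
  case base
  show ?case by simp
next
  case (step n)
  have "N \<le> a + b * n" using step assms(1) by (metis le_trans nat_mult_le_cancel_disj mult_1 le_add2 Suc_leI One_nat_def mult_le_mono1)
  then have "cong_upto N (fps_X ^ (a + b * n) * 1) (0 :: 'a fps)" by (rule cong_upto_X_power_mult)
  then have "cong_upto N (1 - fps_X ^ a * (fps_X ^ b) ^ n) (1 :: 'a fps)"
    by (simp add: cong_upto_def flip: power_add power_mult)
  then have "cong_upto N ((1 - fps_X ^ a * (fps_X ^ b) ^ n) * qpoch (fps_X ^ a) (fps_X ^ b) n)
      (1 * qpoch (fps_X ^ a) (fps_X ^ b) N :: 'a fps)"
    by (intro cong_upto_mult step.IH)
  then show ?case by (simp add: qpoch_Suc)
qed

lemma cong_upto_inverse_qpoch: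
  assumes "a > 0" "b > 0" "N \<le> n"
  shows "cong_upto N (inverse (qpoch (fps_X ^ a) (fps_X ^ b) n)) (inverse (qpoch (fps_X ^ a) (fps_X ^ b) N) :: 'a::field fps)"
  using assms by (intro cong_upto_inverse cong_upto_qpoch) (simp_all add: qpoch_X_nth_0)

text \<open>
  A congruence between cofactors is needed only where the power of \<open>X\<close> in front does not already annihilate
  them. In the limits below the cofactors are only known to agree where that power is small.
\<close>

lemma cong_upto_X_term:
  fixes f g :: "'a::comm_ring_1 fps"
  assumes "e < N \<Longrightarrow> cong_upto N f g"
  shows "cong_upto N (fps_X ^ e * f) (fps_X ^ e * g)"
proof (cases "e < N")
  case True
  then show ?thesis using assms by (intro cong_upto_mult) auto
next
  case False
  then show ?thesis
    using cong_upto_X_power_mult[of N e f] cong_upto_X_power_mult[of N e g] by (simp add: cong_upto_def)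
qed

text \<open>
  For \<open>M \<ge> 2 N\<close> a term whose power of \<open>X\<close> is less than \<open>N\<close> has index less than \<open>N\<close>, hence the orders
  \<open>M - n\<close>, \<open>M - r\<close> and \<open>M + r + 1\<close> of its reciprocals are at least \<open>N\<close>; these reciprocals may all be replaced by the one of order \<open>N\<close>,
  of which one copy cancels.
\<close>

lemma Bailey_identity_limit:
  assumes "2 * N \<le> M"
  shows "cong_upto N
    (\<Sum>n\<le>M. fps_X ^ (2 * n * (n + 1)) * cubic_poch fps_X n * inverse (1 - fps_X ^ (2 * n + 1)) * rfac (fps_X ^ 2) (2 * n))
    ((\<Sum>r\<le>M. (- 1) ^ r * sgn3 r * (fps_X ^ (3 * r\<^sup>2 + 2 * r) + fps_X ^ (3 * r\<^sup>2 + 4 * r + 1)))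
        * inverse (qpoch (fps_X ^ 2) (fps_X ^ 2) N) :: complex fps)"
proof -
  let ?E = "qpoch (fps_X ^ 2) (fps_X ^ 2) N :: complex fps"
  define t :: "nat \<Rightarrow> complex fps" where
    "t n = cubic_poch fps_X n * inverse (1 - fps_X ^ (2 * n + 1)) * rfac (fps_X ^ 2) (2 * n)" for n
  have E: "inverse ?E * ?E = 1"
    by (rule inverse_mult_eq_1) (simp add: qpoch_X_nth_0)
  have R: "cong_upto N (rfac (fps_X ^ 2) n) (inverse ?E)" if "N \<le> n" for n
    unfolding rfac_def using that by (intro cong_upto_inverse_qpoch) auto
  have le: "k \<le> 2 * k * (k + 1)" "k \<le> 3 * k\<^sup>2 + 2 * k" "k \<le> 3 * k\<^sup>2 + 4 * k + 1" for k :: nat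
    by (auto simp: algebra_simps)
  have "cong_upto N (\<Sum>n\<le>M. fps_X ^ (2 * n * (n + 1)) * (t n * inverse ?E))
    (\<Sum>n\<le>M. fps_X ^ (2 * n * (n + 1)) * (t n * rfac (fps_X ^ 2) (M - n)))"
  proof (intro cong_upto_sum cong_upto_X_term cong_upto_mult cong_upto_refl cong_upto_sym[OF R])
    fix n assume "2 * n * (n + 1) < N"
    with le(1)[of n] assms show "N \<le> M - n" by linarith
  qed
  also have "(\<Sum>n\<le>M. fps_X ^ (2 * n * (n + 1)) * (t n * rfac (fps_X ^ 2) (M - n)))
    = (\<Sum>r\<le>M. (- 1) ^ r * sgn3 r * (fps_X ^ (3 * r\<^sup>2 + 2 * r) * (rfac (fps_X ^ 2) (M - r) * rfac (fps_X ^ 2) (M + r + 1))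
        + fps_X ^ (3 * r\<^sup>2 + 4 * r + 1) * (rfac (fps_X ^ 2) (M - r) * rfac (fps_X ^ 2) (M + r + 1))))"
    using finite_Bailey_identity_fps[of M] unfolding t_def by (simp only: mult.assoc distrib_left distrib_right)
  also have "cong_upto N \<dots> (\<Sum>r\<le>M. (- 1) ^ r * sgn3 r * (fps_X ^ (3 * r\<^sup>2 + 2 * r) * (inverse ?E * inverse ?E)
        + fps_X ^ (3 * r\<^sup>2 + 4 * r + 1) * (inverse ?E * inverse ?E)))"
  proof (intro cong_upto_sum cong_upto_mult cong_upto_refl)
    fix r assume "r \<in> {..M}"
    have 1: "cong_upto N (rfac (fps_X ^ 2) (M - r) * rfac (fps_X ^ 2) (M + r + 1)) (inverse ?E * inverse ?E)"
      if "r < N"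
      using that assms by (intro cong_upto_mult R) auto
    have "cong_upto N (fps_X ^ (3 * r\<^sup>2 + 2 * r) * (rfac (fps_X ^ 2) (M - r) * rfac (fps_X ^ 2) (M + r + 1)))
        (fps_X ^ (3 * r\<^sup>2 + 2 * r) * (inverse ?E * inverse ?E))"
      by (intro cong_upto_X_term 1) (use le(2)[of r] in linarith)
    moreover have "cong_upto N (fps_X ^ (3 * r\<^sup>2 + 4 * r + 1) * (rfac (fps_X ^ 2) (M - r) * rfac (fps_X ^ 2) (M + r + 1)))
        (fps_X ^ (3 * r\<^sup>2 + 4 * r + 1) * (inverse ?E * inverse ?E))"
      by (intro cong_upto_X_term 1) (use le(3)[of r] in linarith)
    ultimately show "cong_upto N (fps_X ^ (3 * r\<^sup>2 + 2 * r) * (rfac (fps_X ^ 2) (M - r) * rfac (fps_X ^ 2) (M + r + 1))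
        + fps_X ^ (3 * r\<^sup>2 + 4 * r + 1) * (rfac (fps_X ^ 2) (M - r) * rfac (fps_X ^ 2) (M + r + 1)))
      (fps_X ^ (3 * r\<^sup>2 + 2 * r) * (inverse ?E * inverse ?E)
        + fps_X ^ (3 * r\<^sup>2 + 4 * r + 1) * (inverse ?E * inverse ?E))"
      unfolding cong_upto_def fps_add_nth by metis
  qed
  finally have "cong_upto N ((\<Sum>n\<le>M. fps_X ^ (2 * n * (n + 1)) * (t n * inverse ?E)) * ?E)
    ((\<Sum>r\<le>M. (- 1) ^ r * sgn3 r * (fps_X ^ (3 * r\<^sup>2 + 2 * r) * (inverse ?E * inverse ?E)
        + fps_X ^ (3 * r\<^sup>2 + 4 * r + 1) * (inverse ?E * inverse ?E))) * ?E)"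
    by (intro cong_upto_mult cong_upto_refl)
  moreover have "(\<Sum>n\<le>M. fps_X ^ (2 * n * (n + 1)) * (t n * inverse ?E)) * ?E
     = (\<Sum>n\<le>M. fps_X ^ (2 * n * (n + 1)) * cubic_poch fps_X n * inverse (1 - fps_X ^ (2 * n + 1)) * rfac (fps_X ^ 2) (2 * n))"
    unfolding t_def by (simp only: sum_distrib_right mult.assoc E mult_1_right)
  moreover have "(\<Sum>r\<le>M. (- 1) ^ r * sgn3 r * (fps_X ^ (3 * r\<^sup>2 + 2 * r) * (inverse ?E * inverse ?E)
        + fps_X ^ (3 * r\<^sup>2 + 4 * r + 1) * (inverse ?E * inverse ?E))) * ?E
     = (\<Sum>r\<le>M. (- 1) ^ r * sgn3 r * (fps_X ^ (3 * r\<^sup>2 + 2 * r) + fps_X ^ (3 * r\<^sup>2 + 4 * r + 1))) * inverse ?E"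
    by (simp only: sum_distrib_right mult.assoc distrib_left distrib_right E mult_1_right)
  ultimately show ?thesis by simp
qed

text \<open>
  The same argument for \<open>bilateral_quintuple_fps\<close>: a term with an exponent less than \<open>N\<close> has
  \<open>\<bar>k - m\<bar> < N\<close>, and then both \<open>k\<close> and \<open>2 m - k\<close> are at least \<open>N\<close>.
\<close>

lemma quintuple_limit:
  fixes F :: "nat \<Rightarrow> complex fps"
  assumes m: "2 * N \<le> m"
  defines "F \<equiv> \<lambda>a. qpoch (fps_X ^ a) (fps_X ^ 18) N"
  shows "cong_upto N
    (\<Sum>k\<le>2 * m. (- 1) ^ (k + m) *
      (fps_X ^ nat (27 * (int k - int m)\<^sup>2 - 6 * (int k - int m)) + fps_X ^ nat (27 * (int k - int m)\<^sup>2 + 12 * (int k - int m) + 1)))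
    (F 18 * F 16 * F 2 * inverse (F 17) * inverse (F 1))"
proof -
  define G where "G = inverse (F 18) * inverse (F 18) * inverse (F 16) * inverse (F 2)"
  define H where "H = F 18 * F 18 * F 16 * F 2"
  define h where "h k = inverse (qpoch (fps_X ^ 18) (fps_X ^ 18) k) * inverse (qpoch (fps_X ^ 18) (fps_X ^ 18) (2 * m - k)) *
       inverse (qpoch (fps_X ^ 16) (fps_X ^ 18) (2 * m - k)) * inverse (qpoch (fps_X ^ 2) (fps_X ^ 18) (k + 1) :: complex fps)" for k
  define e1 e2 where "e1 k = nat (27 * (int k - int m)\<^sup>2 - 6 * (int k - int m))"
    and "e2 k = nat (27 * (int k - int m)\<^sup>2 + 12 * (int k - int m) + 1)" for k
  have inv: "inverse (F a) * F a = 1" if "a > 0" for a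
    unfolding F_def using that by (intro inverse_mult_eq_1) (simp add: qpoch_X_nth_0)
  have R: "cong_upto N (inverse (qpoch (fps_X ^ a) (fps_X ^ 18) n)) (inverse (F a))" if "N \<le> n" "a > 0" for n a
    unfolding F_def using that by (intro cong_upto_inverse_qpoch) auto
  have h: "cong_upto N (h k) G" if "\<bar>int k - int m\<bar> < int N" for k
    unfolding h_def G_def using that m by (intro cong_upto_mult R) auto
  have e: "\<bar>int k - int m\<bar> < int N" if "e1 k < N \<or> e2 k < N" for k
  proof -
    define j where "j = int k - int m"
    have "\<bar>j\<bar> \<le> j\<^sup>2" using self_le_power[of "\<bar>j\<bar>" 2] by (cases "j = 0") auto
    then have "\<bar>j\<bar> \<le> 27 * j\<^sup>2 - 6 * j" "\<bar>j\<bar> \<le> 27 * j\<^sup>2 + 12 * j + 1" by linarith+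
    then show ?thesis using that unfolding e1_def e2_def j_def[symmetric] by linarith
  qed
  have "cong_upto N (\<Sum>k\<le>2 * m. (- 1) ^ (k + m) * (fps_X ^ e1 k * G + fps_X ^ e2 k * G))
     (\<Sum>k\<le>2 * m. (- 1) ^ (k + m) * (fps_X ^ e1 k * h k + fps_X ^ e2 k * h k))"
  proof (intro cong_upto_sum cong_upto_mult cong_upto_refl)
    fix k
    have "cong_upto N (fps_X ^ e1 k * G) (fps_X ^ e1 k * h k)"
      by (intro cong_upto_X_term cong_upto_sym[OF h] e) simp
    moreover have "cong_upto N (fps_X ^ e2 k * G) (fps_X ^ e2 k * h k)"
      by (intro cong_upto_X_term cong_upto_sym[OF h] e) simp
    ultimately show "cong_upto N (fps_X ^ e1 k * G + fps_X ^ e2 k * G) (fps_X ^ e1 k * h k + fps_X ^ e2 k * h k)"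
      unfolding cong_upto_def fps_add_nth by metis
  qed
  also have "(\<Sum>k\<le>2 * m. (- 1) ^ (k + m) * (fps_X ^ e1 k * h k + fps_X ^ e2 k * h k))
     = inverse (qpoch (fps_X ^ 18) (fps_X ^ 18) (2 * m)) * inverse (qpoch (fps_X ^ 17) (fps_X ^ 18) m)
       * inverse (qpoch (fps_X ^ 1) (fps_X ^ 18) (m + 1))"
    using bilateral_quintuple_fps[of m] unfolding h_def[symmetric] e1_def[symmetric] e2_def[symmetric]
    by (simp only: mult.assoc distrib_left distrib_right)
  also have "cong_upto N \<dots> (inverse (F 18) * inverse (F 17) * inverse (F 1))"
    using m by (intro cong_upto_mult R) auto
  finally have cong: "cong_upto N ((\<Sum>k\<le>2 * m. (- 1) ^ (k + m) * (fps_X ^ e1 k * G + fps_X ^ e2 k * G)) * H)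
     (inverse (F 18) * inverse (F 17) * inverse (F 1) * H)"
    by (intro cong_upto_mult cong_upto_refl)
  have "G * H = (inverse (F 18) * F 18) * (inverse (F 18) * F 18) * (inverse (F 16) * F 16) * (inverse (F 2) * F 2)"
    unfolding G_def H_def by (simp only: mult_ac)
  then have GH: "G * H = 1" by (simp add: inv)
  have "(\<Sum>k\<le>2 * m. (- 1) ^ (k + m) * (fps_X ^ e1 k * G + fps_X ^ e2 k * G)) * H
      = (\<Sum>k\<le>2 * m. (- 1) ^ (k + m) * (fps_X ^ e1 k + fps_X ^ e2 k))"
    unfolding distrib_right[symmetric] by (simp only: sum_distrib_right mult.assoc GH mult_1_right)
  moreover have "inverse (F 18) * inverse (F 17) * inverse (F 1) * H
      = (inverse (F 18) * F 18) * (F 18 * F 16 * F 2 * inverse (F 17) * inverse (F 1))"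
    unfolding H_def by (simp only: mult_ac)
  ultimately show ?thesis
    using cong inv[of 18] by (simp only: e1_def e2_def mult_1_left zero_less_numeral)
qed

text \<open>
  The factors of \<open>(b\<^sup>s; b\<^sup>s)\<close> are sorted by the residue of their index modulo \<open>d\<close>.
\<close>

lemma qpoch_dissect:
  "qpoch (b ^ s) (b ^ s) (d * N) = (\<Prod>j<d. qpoch (b ^ (s * (j + 1))) (b ^ (s * d)) N)"
proof -
  have "(\<Prod>j<d. qpoch (b ^ (s * (j + 1))) (b ^ (s * d)) N) = (\<Prod>(j, i)\<in>{..<d} \<times> {..<N}. 1 - b ^ (s * (j + 1)) * (b ^ (s * d)) ^ i)"
    by (simp add: qpoch_def prod.cartesian_product)
  also have "\<dots> = (\<Prod>n<d * N. 1 - b ^ s * (b ^ s) ^ n)"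
  proof (rule prod.reindex_bij_witness[of _ "\<lambda>n. (n mod d, n div d)" "\<lambda>(j, i). d * i + j"], goal_cases)
    case (4 n)
    then have "d > 0" by (cases "d = 0") auto
    with 4 show ?case by (auto simp: less_mult_imp_div_less mult.commute)
  next
    case (2 p)
    then obtain j i where p: "p = (j, i)" "j < d" "i < N" by auto
    then have "d * i + j < d * (i + 1)" by simp
    also have "d * (i + 1) \<le> d * N" using p by (intro mult_le_mono2) simp
    finally show ?case using p by (simp add: mult.commute)
  next
    case (5 p)
    then obtain j i where p: "p = (j, i)" by auto
    have "s + s * (d * i + j) = s * (j + 1) + s * d * i" by (simp add: algebra_simps)
    then show ?case by (simp only: p prod.case power_add[symmetric] power_mult[symmetric])
  qed auto
  finally show ?thesis by (simp add: qpoch_def)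
qed

text \<open>
  The series-product identity behind the theorem. By the two limits and
  \<open>theta_rearrangement\<close>, the sum is a quotient of five products of step 18 and \<open>(q\<^sup>2; q\<^sup>2)\<close>. Dissecting the latter modulo 18
  shows which products survive: the even residues 2, 16 and 0 cancel, and 4, 6, 8, 10, 12, 14 remain together with 1 and 17.
\<close>

lemma Slater_mod_18_upto:
  fixes F :: "nat \<Rightarrow> complex fps"
  assumes "6 * N \<le> M" "3 dvd M"
  shows "cong_upto N
    (\<Sum>n\<le>M. fps_X ^ (2 * n * (n + 1)) * cubic_poch fps_X n * inverse (1 - fps_X ^ (2 * n + 1)) * rfac (fps_X ^ 2) (2 * n))
    (\<Prod>a\<in>{1, 4, 6, 8, 10, 12, 14, 17}. inverse (qpoch (fps_X ^ a) (fps_X ^ 18) N) :: complex fps)"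
proof -
  obtain m where M: "M = 3 * m" using assms(2) by blast
  define F where "F a = (qpoch (fps_X ^ a) (fps_X ^ 18) N :: complex fps)" for a
  have inv: "inverse (F a) * F a = 1" if "a > 0" for a
    unfolding F_def using that by (intro inverse_mult_eq_1) (simp add: qpoch_X_nth_0)
  have "cong_upto N
    (\<Sum>n\<le>M. fps_X ^ (2 * n * (n + 1)) * cubic_poch fps_X n * inverse (1 - fps_X ^ (2 * n + 1)) * rfac (fps_X ^ 2) (2 * n))
    ((\<Sum>k\<le>2 * m. (- 1) ^ (k + m) *
      (fps_X ^ nat (27 * (int k - int m)\<^sup>2 - 6 * (int k - int m)) + fps_X ^ nat (27 * (int k - int m)\<^sup>2 + 12 * (int k - int m) + 1)))
        * inverse (qpoch (fps_X ^ 2) (fps_X ^ 2) N) :: complex fps)"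
    using Bailey_identity_limit[of N M] assms(1) unfolding M theta_rearrangement by simp
  also have "cong_upto N \<dots> ((F 18 * F 16 * F 2 * inverse (F 17) * inverse (F 1)) * inverse (qpoch (fps_X ^ 2) (fps_X ^ 2) (9 * N)))"
    unfolding F_def using assms(1) M
    by (intro cong_upto_mult quintuple_limit cong_upto_sym[OF cong_upto_inverse_qpoch]) auto
  also have "qpoch (fps_X ^ 2) (fps_X ^ 2) (9 * N) = F 2 * F 4 * F 6 * F 8 * F 10 * F 12 * F 14 * F 16 * F 18"
    unfolding qpoch_dissect F_def by (simp add: numeral_eq_Suc lessThan_Suc mult_ac)
  also have "(F 18 * F 16 * F 2 * inverse (F 17) * inverse (F 1)) * inverse (F 2 * F 4 * F 6 * F 8 * F 10 * F 12 * F 14 * F 16 * F 18)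
     = (inverse (F 18) * F 18) * (inverse (F 16) * F 16) * (inverse (F 2) * F 2) *
       (inverse (F 1) * inverse (F 4) * inverse (F 6) * inverse (F 8) * inverse (F 10) * inverse (F 12) * inverse (F 14) * inverse (F 17))"
    unfolding fps_inverse_mult by (simp only: mult_ac)
  also have "\<dots> = (\<Prod>a\<in>{1, 4, 6, 8, 10, 12, 14, 17}. inverse (qpoch (fps_X ^ a) (fps_X ^ 18) N))"
    by (simp add: inv) (simp add: F_def mult_ac)
  finally show ?thesis .
qed

section \<open>Generating functions of weighted sets\<close>

definition gf :: "('b \<Rightarrow> nat) \<Rightarrow> 'b set \<Rightarrow> complex fps" where
  "gf w A = Abs_fps (\<lambda>n. of_nat (card {a \<in> A. w a = n}))"

text \<open>
  An infinite level would have \<open>card\<close> zero and falsify the coefficient of the generating function.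
\<close>

definition finite_levels :: "('b \<Rightarrow> nat) \<Rightarrow> 'b set \<Rightarrow> bool" where
  "finite_levels w A \<longleftrightarrow> (\<forall>n. finite {a \<in> A. w a = n})"

lemma gf_nth: "gf w A $ n = of_nat (card {a \<in> A. w a = n})"
  by (simp add: gf_def)

lemma gf_shift_nth: "(fps_X ^ c * gf w A) $ n = of_nat (card {a \<in> A. c + w a = n})"
proof (cases "n < c")
  case True
  then have "{a \<in> A. c + w a = n} = {}" by auto
  then show ?thesis using True by (simp only: fps_X_power_mult_nth if_True card.empty of_nat_0)
next
  case False
  then have "{a \<in> A. c + w a = n} = {a \<in> A. w a = n - c}" by auto
  then show ?thesis using False by (simp add: fps_X_power_mult_nth gf_nth)
qed

lemma gf_image:
  assumes "inj_on h A" "\<And>a. a \<in> A \<Longrightarrow> v (h a) = c + w a"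
  shows "gf v (h ` A) = fps_X ^ c * gf w A"
proof (rule fps_ext)
  fix n
  have "{b \<in> h ` A. v b = n} = h ` {a \<in> A. c + w a = n}" using assms(2) by auto
  moreover have "inj_on h {a \<in> A. c + w a = n}" using assms(1) by (rule inj_on_subset) auto
  ultimately show "gf v (h ` A) $ n = (fps_X ^ c * gf w A) $ n"
    by (simp add: gf_nth gf_shift_nth card_image)
qed

lemma gf_Un:
  assumes "finite_levels w (A \<union> B)" "A \<inter> B = {}"
  shows "gf w (A \<union> B) = gf w A + gf w B"
proof (rule fps_ext)
  fix n
  have e: "{a \<in> A \<union> B. w a = n} = {a \<in> A. w a = n} \<union> {a \<in> B. w a = n}" by auto
  have "finite ({a \<in> A. w a = n} \<union> {a \<in> B. w a = n})"
    using assms(1) unfolding e[symmetric] by (simp add: finite_levels_def)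
  then have "card {a \<in> A \<union> B. w a = n} = card {a \<in> A. w a = n} + card {a \<in> B. w a = n}"
    unfolding e using assms(2) by (intro card_Un_disjoint) auto
  then show "gf w (A \<union> B) $ n = (gf w A + gf w B) $ n" by (simp add: gf_nth)
qed

lemma levels_Times:
  "{p \<in> A \<times> B. w (fst p) + v (snd p) = (n::nat)}
    = (\<Union>i\<in>{0..n}. {a \<in> A. w a = i} \<times> {b \<in> B. v b = n - i})"
  by auto

lemma finite_levels_Times:
  assumes "finite_levels w A" "finite_levels v B"
  shows "finite_levels (\<lambda>p. w (fst p) + v (snd p)) (A \<times> B)"
  using assms unfolding finite_levels_def levels_Times by auto

lemma gf_Times:
  assumes "finite_levels w A" "finite_levels v B"
  shows "gf (\<lambda>p. w (fst p) + v (snd p)) (A \<times> B) = gf w A * gf v B"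
proof (rule fps_ext)
  fix n
  have "card {p \<in> A \<times> B. w (fst p) + v (snd p) = n}
      = (\<Sum>i=0..n. card ({a \<in> A. w a = i} \<times> {b \<in> B. v b = n - i}))"
    unfolding levels_Times using assms
    by (intro card_UN_disjoint) (auto simp: finite_levels_def)
  then show "gf (\<lambda>p. w (fst p) + v (snd p)) (A \<times> B) $ n = (gf w A * gf v B) $ n"
    by (simp add: gf_nth fps_mult_nth card_cartesian_product)
qed

section \<open>Generating functions of families of multisets\<close>

lemma finite_bounded_multisets:
  assumes "finite S"
  shows "finite {M. set_mset M \<subseteq> S \<and> size M \<le> n}"
proof (rule finite_subset)
  show "{M. set_mset M \<subseteq> S \<and> size M \<le> n} \<subseteq> mset ` {xs. set xs \<subseteq> S \<and> length xs \<le> n}"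
  proof
    fix M assume "M \<in> {M. set_mset M \<subseteq> S \<and> size M \<le> n}"
    moreover obtain xs where "mset xs = M" using ex_mset by blast
    ultimately show "M \<in> mset ` {xs. set xs \<subseteq> S \<and> length xs \<le> n}" by force
  qed
qed (use assms in \<open>auto intro: finite_lists_length_le\<close>)

lemma size_le_sum_mset: "0 \<notin># M \<Longrightarrow> size M \<le> sum_mset (M :: nat multiset)"
  by (induction M) auto

lemma finite_levels_parts:
  assumes "finite S" "0 \<notin> S"
  shows "finite_levels sum_mset {M. set_mset M \<subseteq> (S :: nat set)}"
  unfolding finite_levels_def
proof
  fix n
  show "finite {M \<in> {M. set_mset M \<subseteq> S}. sum_mset M = n}"
  proof (rule finite_subset)
    show "{M \<in> {M. set_mset M \<subseteq> S}. sum_mset M = n} \<subseteq> {M. set_mset M \<subseteq> S \<and> size M \<le> n}"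
    proof
      fix M assume M: "M \<in> {M \<in> {M. set_mset M \<subseteq> S}. sum_mset M = n}"
      then have "0 \<notin># M" using assms(2) by auto
      then show "M \<in> {M. set_mset M \<subseteq> S \<and> size M \<le> n}" using M size_le_sum_mset by auto
    qed
  qed (rule finite_bounded_multisets[OF assms(1)])
qed

text \<open>
  The form in which the generating functions of the infinite families below are found: the set is split into a part with known generating
  function \<open>h\<close> and a shifted copy of itself.
\<close>

lemma geometric_recurrence: "g = h + x * g \<Longrightarrow> (1 - x) * g = (h :: 'a::comm_ring_1)"
  by (metis add_diff_cancel_right' left_diff_distrib mult_1_left)

text \<open>
  A multiset over \<open>S \<union> {s}\<close> either avoids \<open>s\<close> or arises by adding one more copy of \<open>s\<close>.
\<close>

lemma gf_parts:
  assumes "finite S" "0 \<notin> (S :: nat set)"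
  shows "gf sum_mset {M. set_mset M \<subseteq> S} = (\<Prod>s\<in>S. inverse (1 - fps_X ^ s))"
  using assms
proof (induction S rule: finite_induct)
  case empty
  have "gf sum_mset {M :: nat multiset. set_mset M \<subseteq> {}} = 1"
  proof (rule fps_ext)
    fix n
    have "{M \<in> {M :: nat multiset. set_mset M \<subseteq> {}}. sum_mset M = n} = (if n = 0 then {{#}} else {})" by auto
    then show "gf sum_mset {M :: nat multiset. set_mset M \<subseteq> {}} $ n = 1 $ n" by (simp add: gf_nth)
  qed
  then show ?case by simp
next
  case (insert s S)
  let ?A = "{M. set_mset M \<subseteq> insert s S}" and ?B = "{M. set_mset M \<subseteq> S}"
  have "?A = ?B \<union> add_mset s ` ?A"
  proof (intro equalityI subsetI)
    fix M assume M: "M \<in> ?A"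
    show "M \<in> ?B \<union> add_mset s ` ?A"
    proof (cases "s \<in># M")
      case True
      then have "M = add_mset s (M - {#s#})" by (rule insert_DiffM[symmetric])
      moreover have "M - {#s#} \<in> ?A" using M by (auto dest: in_diffD)
      ultimately show ?thesis by blast
    next
      case False
      then show ?thesis using M by auto
    qed
  qed auto
  moreover have "?B \<inter> add_mset s ` ?A = {}" using insert.hyps by auto
  ultimately have "gf sum_mset ?A = gf sum_mset ?B + gf sum_mset (add_mset s ` ?A)"
    using gf_Un[of sum_mset ?B "add_mset s ` ?A"] finite_levels_parts[of "insert s S"] insert by simp
  also have "gf sum_mset (add_mset s ` ?A) = fps_X ^ s * gf sum_mset ?A"
    by (rule gf_image) (auto simp: inj_on_def)
  finally have rec: "(1 - fps_X ^ s) * gf sum_mset ?A = gf sum_mset ?B"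
    by (rule geometric_recurrence)
  have "s > 0" using insert.prems by auto
  then have "inverse (1 - fps_X ^ s) * (1 - fps_X ^ s) = (1 :: complex fps)"
    by (intro inverse_mult_eq_1) simp
  then have "gf sum_mset ?A = inverse (1 - fps_X ^ s) * ((1 - fps_X ^ s) * gf sum_mset ?A)"
    by (simp add: mult.assoc[symmetric])
  then show ?case unfolding rec using insert by simp
qed

lemma gf_multiples:
  assumes "m > 0"
  shows "gf (\<lambda>j. m * j) UNIV = inverse (1 - fps_X ^ m)"
    and "finite_levels (\<lambda>j. m * j) UNIV"
proof -
  show fin: "finite_levels (\<lambda>j. m * j) UNIV"
    unfolding finite_levels_def
  proof
    fix n
    show "finite {a \<in> UNIV. m * a = n}"
      by (rule finite_subset[of _ "{..n}"]) (use assms in auto)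
  qed
  have U: "(UNIV :: nat set) = {0} \<union> Suc ` UNIV" using not0_implies_Suc by auto
  have "gf (\<lambda>j. m * j) UNIV = gf (\<lambda>j. m * j) {0} + gf (\<lambda>j. m * j) (Suc ` UNIV)"
    using gf_Un[of "\<lambda>j. m * j" "{0}" "Suc ` UNIV"] fin unfolding U[symmetric] by simp
  also have "gf (\<lambda>j. m * j) (Suc ` UNIV) = fps_X ^ m * gf (\<lambda>j. m * j) UNIV"
    by (rule gf_image) auto
  also have "gf (\<lambda>j. m * j) {0} = 1"
  proof (rule fps_ext)
    fix n
    have "{a \<in> {0}. m * a = n} = (if n = 0 then {0} else {})" by auto
    then show "gf (\<lambda>j. m * j) {0} $ n = 1 $ n" by (simp add: gf_nth)
  qed
  finally have "(1 - fps_X ^ m) * gf (\<lambda>j. m * j) UNIV = 1" by (rule geometric_recurrence)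
  then show "gf (\<lambda>j. m * j) UNIV = inverse (1 - fps_X ^ m)"
    by (rule fps_inverse_unique[symmetric])
qed

lemma sum_mset_image_Suc: "sum_mset (image_mset Suc M) = sum_mset M + size M"
  by (induction M) auto

lemma finite_levels_of_size: "finite_levels (\<lambda>M. 2 * sum_mset M) {M :: nat multiset. size M = L}"
  unfolding finite_levels_def
proof
  fix n
  show "finite {M \<in> {M :: nat multiset. size M = L}. 2 * sum_mset M = n}"
  proof (rule finite_subset)
    show "{M \<in> {M :: nat multiset. size M = L}. 2 * sum_mset M = n} \<subseteq> {M. set_mset M \<subseteq> {..n} \<and> size M \<le> L}"
    proof clarify
      fix M :: "nat multiset"
      have "x \<le> 2 * sum_mset M" if x: "x \<in># M" for x
      proof -
        obtain N where "M = add_mset x N" using multi_member_split[OF x] by blast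
        then show ?thesis by simp
      qed
      then show "set_mset M \<subseteq> {..2 * sum_mset M} \<and> size M \<le> size M" by auto
    qed
  qed (rule finite_bounded_multisets, simp)
qed

text \<open>
  A multiset of \<open>L + 1\<close> natural numbers either contains 0, which can be removed, or is the successor image of
  another such multiset. The sum counts twice because the multisets will encode even parts by their halves.
\<close>

lemma gf_of_size: "gf (\<lambda>M. 2 * sum_mset M) {M :: nat multiset. size M = L} = rfac (fps_X ^ 2) L"
proof -
  let ?w = "\<lambda>M :: nat multiset. 2 * sum_mset M"
  let ?C = "\<lambda>L. {M :: nat multiset. size M = L}"
  have "qpoch (fps_X ^ 2) (fps_X ^ 2) L * gf ?w (?C L) = 1"
  proof (induction L)
    case 0
    have "gf ?w (?C 0) = 1"
    proof (rule fps_ext)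
      fix n
      have "{M \<in> ?C 0. ?w M = n} = (if n = 0 then {{#}} else {})" by auto
      then show "gf ?w (?C 0) $ n = 1 $ n" by (simp add: gf_nth)
    qed
    then show ?case by simp
  next
    case (Suc L)
    have C: "?C (Suc L) = add_mset 0 ` ?C L \<union> image_mset Suc ` ?C (Suc L)"
    proof (intro equalityI subsetI)
      fix M assume M: "M \<in> ?C (Suc L)"
      show "M \<in> add_mset 0 ` ?C L \<union> image_mset Suc ` ?C (Suc L)"
      proof (cases "0 \<in># M")
        case True
        then have "M = add_mset 0 (M - {#0#})" by (rule insert_DiffM[symmetric])
        moreover have "M - {#0#} \<in> ?C L" using M True by (simp add: size_Diff_singleton)
        ultimately show ?thesis by blast
      next
        case False
        have "Suc (x - 1) = x" if "x \<in># M" for x using that False by (cases x) auto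
        then have "image_mset Suc (image_mset (\<lambda>x. x - 1) M) = image_mset (\<lambda>x. x) M"
          unfolding multiset.map_comp by (intro image_mset_cong) simp
        then have "M = image_mset Suc (image_mset (\<lambda>x. x - 1) M)" by simp
        then show ?thesis using M by (metis UnCI imageI mem_Collect_eq size_image_mset)
      qed
    qed auto
    have disj: "add_mset 0 ` ?C L \<inter> image_mset Suc ` ?C (Suc L) = {}"
    proof -
      have "add_mset 0 M \<noteq> image_mset Suc N" for M N
      proof
        assume "add_mset 0 M = image_mset Suc N"
        then have "0 \<in># image_mset Suc N" by (metis union_single_eq_member)
        then show False by auto
      qed
      then show ?thesis by blast
    qed
    have "gf ?w (?C (Suc L)) = gf ?w (add_mset 0 ` ?C L) + gf ?w (image_mset Suc ` ?C (Suc L))"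
      using gf_Un[of ?w "add_mset 0 ` ?C L" "image_mset Suc ` ?C (Suc L)", unfolded C[symmetric]]
        finite_levels_of_size[of "Suc L"] disj by blast
    also have "gf ?w (add_mset 0 ` ?C L) = fps_X ^ 0 * gf ?w (?C L)"
      by (rule gf_image) (auto simp: inj_on_def)
    also have "gf ?w (image_mset Suc ` ?C (Suc L)) = fps_X ^ (2 * Suc L) * gf ?w (?C (Suc L))"
    proof (rule gf_image)
      have "image_mset (\<lambda>x. x - 1) (image_mset Suc M) = M" for M
        unfolding multiset.map_comp by (simp add: comp_def)
      then show "inj_on (image_mset Suc) (?C (Suc L))" by (rule inj_on_inverseI)
    qed (auto simp: sum_mset_image_Suc)
    also have "fps_X ^ (2 * Suc L) = (fps_X ^ 2 * (fps_X ^ 2) ^ L :: complex fps)"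
      by (simp only: power_mult mult_Suc_right power_add)
    finally have "(1 - fps_X ^ 2 * (fps_X ^ 2) ^ L) * gf ?w (?C (Suc L)) = gf ?w (?C L)"
      by (intro geometric_recurrence) simp
    then show ?case using Suc by (simp only: qpoch_Suc) (simp only: mult_ac)
  qed
  then show ?thesis unfolding rfac_def by (rule fps_inverse_unique[symmetric])
qed

text \<open>
  Split by the multiplicity of \<open>m\<close>, which is 0, 1 or 2.
\<close>

lemma submultisets_add_twice:
  assumes "m \<notin># A"
  shows "{M. M \<subseteq># add_mset m (add_mset m A)}
    = {M. M \<subseteq># A} \<union> (add_mset m ` {M. M \<subseteq># A} \<union> (\<lambda>M. add_mset m (add_mset m M)) ` {M. M \<subseteq># A})"
proof (intro equalityI subsetI)
  fix M assume M: "M \<in> {M. M \<subseteq># add_mset m (add_mset m A)}"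
  define N where "N = filter_mset (\<lambda>x. x \<noteq> m) M"
  have Mdec: "M = replicate_mset (count M m) m + N"
    by (rule multiset_eqI) (auto simp: N_def)
  have cnt: "count M x \<le> (if x = m then 2 else 0) + count A x" for x
    using mset_subset_eq_count[of M "add_mset m (add_mset m A)" x] M by (auto split: if_splits)
  have N: "N \<subseteq># A"
  proof (rule mset_subset_eqI)
    fix x show "count N x \<le> count A x" using cnt[of x] by (auto simp: N_def)
  qed
  have "count M m \<le> 2" using cnt[of m] assms by (simp add: not_in_iff)
  then consider "count M m = 0" | "count M m = 1" | "count M m = 2" by linarith
  then show "M \<in> {M. M \<subseteq># A} \<union> (add_mset m ` {M. M \<subseteq># A} \<union> (\<lambda>M. add_mset m (add_mset m M)) ` {M. M \<subseteq># A})"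
  proof cases
    case 1
    then have "M = N" using Mdec by simp
    then show ?thesis using N by simp
  next
    case 2
    then have "M = add_mset m N" using Mdec by simp
    then show ?thesis using N by blast
  next
    case 3
    then have "M = add_mset m (add_mset m N)" using Mdec by (simp add: numeral_2_eq_2)
    then show ?thesis using N by blast
  qed
next
  fix M assume "M \<in> {M. M \<subseteq># A} \<union> (add_mset m ` {M. M \<subseteq># A} \<union> (\<lambda>M. add_mset m (add_mset m M)) ` {M. M \<subseteq># A})"
  then show "M \<in> {M. M \<subseteq># add_mset m (add_mset m A)}"
    by (auto intro: subset_mset.order_trans[of _ A] simp: subset_mset.le_iff_add)
qed

text \<open>
  The largest admissible collection of negative parts for \<open>m = 2 k + 1\<close>. The admissible collections are its
  submultisets, and complementation in it reverses the sign with which a negative part counts.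
\<close>

primrec twice_odds :: "nat \<Rightarrow> nat multiset" where
  "twice_odds 0 = {#}"
| "twice_odds (Suc k) = add_mset (2 * k + 1) (add_mset (2 * k + 1) (twice_odds k))"

lemma count_twice_odds: "count (twice_odds k) x = (if odd x \<and> x < 2 * k then 2 else 0)"
  by (induction k) (auto elim: oddE)

lemma sum_twice_odds: "sum_mset (twice_odds k) = 2 * k\<^sup>2"
  by (induction k) (auto simp: power2_eq_square)

lemma finite_submultisets: "finite {M. M \<subseteq># A}"
proof (rule finite_subset)
  show "{M. M \<subseteq># A} \<subseteq> {M. set_mset M \<subseteq> set_mset A \<and> size M \<le> size A}"
    by (auto dest: mset_subset_eqD size_mset_mono)
qed (rule finite_bounded_multisets, simp)

lemma finite_levels_submultisets: "finite_levels w {M. M \<subseteq># A}"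
  unfolding finite_levels_def using finite_submultisets[of A] by (auto intro: finite_subset[rotated])

lemma gf_twice_odds: "gf sum_mset {M. M \<subseteq># twice_odds k} = cubic_poch fps_X k"
proof (induction k)
  case 0
  show ?case
  proof (rule fps_ext)
    fix n
    have "{M \<in> {M. M \<subseteq># twice_odds 0}. sum_mset M = n} = (if n = 0 then {{#}} else {})" by auto
    then show "gf sum_mset {M. M \<subseteq># twice_odds 0} $ n = cubic_poch fps_X 0 $ n"
      by (simp add: gf_nth cubic_poch_def)
  qed
next
  case (Suc k)
  define m where "m = 2 * k + 1"
  let ?A = "{M. M \<subseteq># twice_odds k}"
  let ?B = "add_mset m ` ?A" and ?C = "(\<lambda>M. add_mset m (add_mset m M)) ` ?A"
  have cA: "count M m = 0" if "M \<in> ?A" for M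
    using mset_subset_eq_count[of M "twice_odds k" m] that by (simp add: count_twice_odds m_def)
  have "m \<notin># twice_odds k" by (simp add: not_in_iff count_twice_odds m_def)
  then have S: "{M. M \<subseteq># twice_odds (Suc k)} = ?A \<union> (?B \<union> ?C)"
    using submultisets_add_twice by (simp add: m_def)
  have cB: "count M m = 1" if "M \<in> ?B" for M using that cA by auto
  have cC: "count M m = 2" if "M \<in> ?C" for M using that cA by auto
  have "finite_levels sum_mset (?A \<union> (?B \<union> ?C))" "finite_levels sum_mset (?B \<union> ?C)"
    using finite_submultisets[of "twice_odds k"] by (auto simp: finite_levels_def)
  moreover have "?A \<inter> (?B \<union> ?C) = {}" "?B \<inter> ?C = {}"
    using cA cB cC by fastforce+
  ultimately have "gf sum_mset (?A \<union> (?B \<union> ?C)) = gf sum_mset ?A + (gf sum_mset ?B + gf sum_mset ?C)"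
    by (simp add: gf_Un)
  also have "gf sum_mset ?B = fps_X ^ m * gf sum_mset ?A"
    by (rule gf_image) (auto simp: inj_on_def)
  also have "gf sum_mset ?C = fps_X ^ (m + m) * gf sum_mset ?A"
    by (rule gf_image) (auto simp: inj_on_def)
  also have "m + m = 4 * k + 2" by (simp add: m_def)
  finally show ?case unfolding S Suc.IH
    by (simp only: cubic_poch_def prod.lessThan_Suc m_def) (simp only: distrib_left distrib_right mult_1_left mult_1_right mult_ac add_ac)
qed

section \<open>The signed partitions with odd part 2k+1\<close>

text \<open>
  The pairs of the theorem with \<open>m = 2 k + 1\<close>, as multisets. The weight condition is \<open>|P| - |V| = n + 1\<close>.
\<close>

definition signed_family :: "nat \<Rightarrow> nat \<Rightarrow> (nat multiset \<times> nat multiset) set" where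
  "signed_family k n = {(P, V). 2 * k + 1 \<in># P \<and> (\<forall>x\<in>#P. odd x \<longrightarrow> x = 2 * k + 1) \<and>
     size (filter_mset even P) = 2 * k \<and> (\<forall>x\<in>#P. even x \<longrightarrow> x \<ge> 2 * k) \<and>
     V \<subseteq># twice_odds k \<and> sum_mset P = n + 1 + sum_mset V}"

definition signed_family_weight :: "nat \<Rightarrow> nat \<times> nat multiset \<times> nat multiset \<Rightarrow> nat" where
  "signed_family_weight k = (\<lambda>p. (2 * k + 1) * fst p + (2 * sum_mset (fst (snd p)) + sum_mset (snd (snd p))))"

text \<open>
  Free parameters of the pairs with \<open>m = 2 k + 1\<close>: the number of copies of \<open>m\<close> beyond the first, the
  numbers \<open>(x - 2 k) / 2\<close> for the even parts \<open>x\<close>, and the complement of the negative parts in \<open>twice_odds k\<close>.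
\<close>

definition signed_family_params :: "nat \<Rightarrow> (nat \<times> nat multiset \<times> nat multiset) set" where
  "signed_family_params k = UNIV \<times> {M. size M = 2 * k} \<times> {W. W \<subseteq># twice_odds k}"

lemma
  shows gf_signed_family_params: "gf (signed_family_weight k) (signed_family_params k)
      = inverse (1 - fps_X ^ (2 * k + 1)) * (rfac (fps_X ^ 2) (2 * k) * cubic_poch fps_X k)" (is ?gf)
    and finite_levels_signed_family_params: "finite_levels (signed_family_weight k) (signed_family_params k)" (is ?fin)
proof -
  let ?A = "{M :: nat multiset. size M = 2 * k}" and ?B = "{W. W \<subseteq># twice_odds k}"
  let ?v = "\<lambda>p :: nat multiset \<times> nat multiset. 2 * sum_mset (fst p) + sum_mset (snd p)"
  have fin: "finite_levels ?v (?A \<times> ?B)"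
    by (intro finite_levels_Times finite_levels_of_size finite_levels_submultisets)
  have fin1: "finite_levels (\<lambda>j. (2 * k + 1) * j) UNIV"
    by (rule gf_multiples(2)) simp
  show ?fin
    unfolding signed_family_params_def signed_family_weight_def by (rule finite_levels_Times[OF fin1 fin])
  have "gf (signed_family_weight k) (signed_family_params k) = gf (\<lambda>j. (2 * k + 1) * j) UNIV * gf ?v (?A \<times> ?B)"
    unfolding signed_family_params_def signed_family_weight_def by (rule gf_Times[OF fin1 fin])
  also have "gf ?v (?A \<times> ?B) = gf (\<lambda>M. 2 * sum_mset M) ?A * gf sum_mset ?B"
    by (intro gf_Times finite_levels_of_size finite_levels_submultisets)
  finally show ?gf
    by (simp only: gf_of_size gf_twice_odds gf_multiples(1) zero_less_Suc Suc_eq_plus1[symmetric])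
qed

lemma sum_mset_affine: "sum_mset (image_mset (\<lambda>x. 2 * x + c) M) = 2 * sum_mset M + c * size (M :: nat multiset)"
  by (induction M) auto

lemma sum_mset_Diff_submultiset: "W \<subseteq># A \<Longrightarrow> sum_mset (A - W) + sum_mset W = sum_mset (A :: nat multiset)"
  by (metis subset_mset.diff_add sum_mset.union)

text \<open>
  The constant \<open>2 k\<^sup>2 + 2 k\<close> comes from the weights: \<open>2 k + 1\<close> for the first copy of \<open>m\<close>, \<open>(2 k)\<^sup>2\<close> for
  lifting the \<open>2 k\<close> even parts, \<open>- 2 k\<^sup>2\<close> for complementing the negative parts, and \<open>- 1\<close> because the signed partitions are
  those of \<open>n + 1\<close>.
\<close>

lemma signed_family_bij:
  "bij_betw (\<lambda>(j, M, W). (replicate_mset (Suc j) (2 * k + 1) + image_mset (\<lambda>x. 2 * x + 2 * k) M, twice_odds k - W))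
     {p \<in> signed_family_params k. (2 * k\<^sup>2 + 2 * k) + signed_family_weight k p = n} (signed_family k n)"
proof (rule bij_betw_byWitness[where f' = "\<lambda>(P, V). (count P (2 * k + 1) - 1,
      image_mset (\<lambda>x. (x - 2 * k) div 2) (filter_mset even P), twice_odds k - V)"], goal_cases)
  let ?f = "\<lambda>(j, M, W). (replicate_mset (Suc j) (2 * k + 1) + image_mset (\<lambda>x. 2 * x + 2 * k) M, twice_odds k - W)"
  let ?g = "\<lambda>(P, V). (count P (2 * k + 1) - 1,
      image_mset (\<lambda>x. (x - 2 * k) div 2) (filter_mset even P), twice_odds k - V)"
  have diff: "A - (A - W) = W" if "W \<subseteq># A" for A W :: "nat multiset"
    using that by (metis add_diff_cancel_right' subset_mset.add_diff_inverse union_commute)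
  have cnt: "count (image_mset (\<lambda>x. 2 * x + 2 * k) M) (2 * k + 1) = 0" for M
  proof -
    have "2 * k + 1 \<noteq> 2 * x + 2 * k" for x :: nat by presburger
    then show ?thesis unfolding not_in_iff[symmetric] by (auto simp del: One_nat_def)
  qed
  have evens: "filter_mset even (image_mset (\<lambda>x. 2 * x + 2 * k) M) = image_mset (\<lambda>x. 2 * x + 2 * k) M" for M
    by (simp add: filter_mset_eq_conv)
  have noodd: "filter_mset even (replicate_mset j (2 * k + 1)) = {#}" for j
    by (induction j) auto
  have fg: "?f (?g p) = p" if p: "p \<in> signed_family k n" for p
  proof -
    obtain P V where pPV: "p = (P, V)" by (cases p)
    have P: "2 * k + 1 \<in># P" "\<And>x. x \<in># P \<Longrightarrow> odd x \<Longrightarrow> x = 2 * k + 1" "\<And>x. x \<in># P \<Longrightarrow> even x \<Longrightarrow> x \<ge> 2 * k"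
      and V: "V \<subseteq># twice_odds k"
      using p by (auto simp: pPV signed_family_def)
    have c: "Suc (count P (2 * k + 1) - 1) = count P (2 * k + 1)" using P(1) by (simp add: count_greater_zero_iff[symmetric] del: count_greater_zero_iff)
    have "image_mset (\<lambda>x. 2 * x + 2 * k) (image_mset (\<lambda>x. (x - 2 * k) div 2) (filter_mset even P))
        = image_mset (\<lambda>x. x) (filter_mset even P)"
      unfolding multiset.map_comp using P(3) by (intro image_mset_cong) (auto elim!: evenE)
    then have e: "image_mset (\<lambda>x. 2 * x + 2 * k) (image_mset (\<lambda>x. (x - 2 * k) div 2) (filter_mset even P))
        = filter_mset even P" by simp
    have dec: "P = replicate_mset (count P (2 * k + 1)) (2 * k + 1) + filter_mset even P"
    proof (rule multiset_eqI)
      fix x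
      show "count P x = count (replicate_mset (count P (2 * k + 1)) (2 * k + 1) + filter_mset even P) x"
        using P(2)[of x] by (cases "even x"; cases "x = 2 * k + 1") (auto simp: count_eq_zero_iff)
    qed
    show ?thesis by (simp only: pPV prod.case c e diff[OF V] dec[symmetric])
  qed
  case 1
  show ?case
  proof
    fix p assume p: "p \<in> {p \<in> signed_family_params k. (2 * k\<^sup>2 + 2 * k) + signed_family_weight k p = n}"
    obtain j M W where [simp]: "p = (j, M, W)" by (cases p) auto
    have "W \<subseteq># twice_odds k" using p by (simp add: signed_family_params_def)
    then show "?g (?f p) = p"
      using cnt[of M] evens[of M] noodd[of "Suc j"]
      by (simp add: diff multiset.map_comp comp_def del: replicate_mset_Suc)
  qed
  case 2
  show ?case using fg by blast
  case 3
  show ?case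
  proof
    fix q assume "q \<in> ?f ` {p \<in> signed_family_params k. (2 * k\<^sup>2 + 2 * k) + signed_family_weight k p = n}"
    then obtain j M W where q: "q = (replicate_mset (Suc j) (2 * k + 1) + image_mset (\<lambda>x. 2 * x + 2 * k) M, twice_odds k - W)"
      and M: "size M = 2 * k" and W: "W \<subseteq># twice_odds k"
      and wt: "(2 * k\<^sup>2 + 2 * k) + ((2 * k + 1) * j + (2 * sum_mset M + sum_mset W)) = n"
      by (auto simp: signed_family_params_def signed_family_weight_def)
    have s: "sum_mset (twice_odds k - W) + sum_mset W = 2 * k\<^sup>2"
      using sum_mset_Diff_submultiset[OF W] by (simp add: sum_twice_odds)
    have "sum_mset (replicate_mset (Suc j) (2 * k + 1) + image_mset (\<lambda>x. 2 * x + 2 * k) M)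
        = Suc j * (2 * k + 1) + (2 * sum_mset M + 2 * k * (2 * k))"
      by (simp only: sum_mset.union sum_mset_replicate_mset sum_mset_affine M of_nat_id)
    also have "\<dots> = n + 1 + sum_mset (twice_odds k - W)"
      using wt s by (simp add: algebra_simps power2_eq_square)
    finally have "sum_mset (replicate_mset (Suc j) (2 * k + 1) + image_mset (\<lambda>x. 2 * x + 2 * k) M)
      = n + 1 + sum_mset (twice_odds k - W)" .
    moreover have "size (filter_mset even (replicate_mset (Suc j) (2 * k + 1) + image_mset (\<lambda>x. 2 * x + 2 * k) M)) = 2 * k"
      using noodd[of "Suc j"] evens[of M] M by (simp del: replicate_mset_Suc)
    ultimately show "q \<in> signed_family k n"
      unfolding q signed_family_def by auto
  qed
  case 4
  show ?case
  proof
    fix q assume "q \<in> ?g ` signed_family k n"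
    then obtain P V where pPV: "(P, V) \<in> signed_family k n" and q: "q = ?g (P, V)" by auto
    define j M W where "j = count P (2 * k + 1) - 1"
      and "M = image_mset (\<lambda>x. (x - 2 * k) div 2) (filter_mset even P)" and "W = twice_odds k - V"
    have q: "q = (j, M, W)" by (simp add: q j_def M_def W_def)
    have "?f (j, M, W) = (P, V)" using fg[OF pPV] by (simp only: j_def M_def W_def prod.case)
    then have P: "P = replicate_mset (Suc j) (2 * k + 1) + image_mset (\<lambda>x. 2 * x + 2 * k) M" by simp
    have M: "size M = 2 * k" and V: "V \<subseteq># twice_odds k" and sum: "sum_mset P = n + 1 + sum_mset V"
      using pPV by (auto simp: signed_family_def M_def)
    have W: "W \<subseteq># twice_odds k" by (simp add: W_def)
    have s: "sum_mset W + sum_mset V = 2 * k\<^sup>2"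
      using sum_mset_Diff_submultiset[OF V] by (simp add: sum_twice_odds W_def)
    have "sum_mset P = Suc j * (2 * k + 1) + (2 * sum_mset M + 2 * k * (2 * k))"
      unfolding P by (simp only: sum_mset.union sum_mset_replicate_mset sum_mset_affine M of_nat_id)
    then have "(2 * k\<^sup>2 + 2 * k) + ((2 * k + 1) * j + (2 * sum_mset M + sum_mset W)) = n"
      using sum s by (simp add: algebra_simps power2_eq_square)
    then show "q \<in> {p \<in> signed_family_params k. (2 * k\<^sup>2 + 2 * k) + signed_family_weight k p = n}"
      using M W by (simp add: q signed_family_params_def signed_family_weight_def)
  qed
qed

lemma card_signed_family:
  "of_nat (card (signed_family k n)) = (fps_X ^ (2 * k * (k + 1)) * cubic_poch fps_X k * inverse (1 - fps_X ^ (2 * k + 1)) * rfac (fps_X ^ 2) (2 * k) :: complex fps) $ n"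
proof -
  have "card (signed_family k n) = card {p \<in> signed_family_params k. (2 * k\<^sup>2 + 2 * k) + signed_family_weight k p = n}"
    using bij_betw_same_card[OF signed_family_bij] by (rule sym)
  then have "(of_nat (card (signed_family k n)) :: complex) = (fps_X ^ (2 * k\<^sup>2 + 2 * k) * gf (signed_family_weight k) (signed_family_params k)) $ n"
    by (simp only: gf_shift_nth)
  moreover have "2 * k\<^sup>2 + 2 * k = 2 * k * (k + 1)" by (simp add: power2_eq_square algebra_simps)
  ultimately show ?thesis by (simp only: gf_signed_family_params mult_ac)
qed

lemma finite_signed_family: "finite (signed_family k n)"
proof -
  have "finite {p \<in> signed_family_params k. (2 * k\<^sup>2 + 2 * k) + signed_family_weight k p = n}"
  proof (rule finite_subset)
    show "{p \<in> signed_family_params k. (2 * k\<^sup>2 + 2 * k) + signed_family_weight k p = n}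
      \<subseteq> {p \<in> signed_family_params k. signed_family_weight k p = n - (2 * k\<^sup>2 + 2 * k)}" by auto
    show "finite {p \<in> signed_family_params k. signed_family_weight k p = n - (2 * k\<^sup>2 + 2 * k)}"
      using finite_levels_signed_family_params[of k] by (simp add: finite_levels_def)
  qed
  then show ?thesis using bij_betw_finite[OF signed_family_bij] by blast
qed

lemma signed_family_empty:
  assumes "n < k"
  shows "signed_family k n = {}"
proof -
  have "{p \<in> signed_family_params k. (2 * k\<^sup>2 + 2 * k) + signed_family_weight k p = n} = {}" using assms by auto
  then have "card (signed_family k n) = 0"
    using bij_betw_same_card[OF signed_family_bij, of k n] by (simp only: card.empty)
  then show ?thesis using finite_signed_family by simp
qed

lemma signed_family_disjoint:
  assumes "k \<noteq> k'"
  shows "signed_family k n \<inter> signed_family k' n = {}"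
proof (rule ccontr)
  assume "signed_family k n \<inter> signed_family k' n \<noteq> {}"
  then obtain P V where "(P, V) \<in> signed_family k n" "(P, V) \<in> signed_family k' n" by auto
  then have "2 * k + 1 \<in># P" and "\<forall>x\<in>#P. odd x \<longrightarrow> x = 2 * k' + 1"
    unfolding signed_family_def by blast+
  then have "2 * k + 1 = 2 * k' + 1" by (auto simp del: One_nat_def)
  then show False using assms by simp
qed

section \<open>From multisets back to partitions\<close>

lemma inj_on_mset_partitions: "inj_on mset {xs. is_partition xs}"
proof (rule inj_onI)
  fix xs ys assume xs: "xs \<in> {xs. is_partition xs}" and ys: "ys \<in> {xs. is_partition xs}" and eq: "mset xs = mset ys"
  have "sorted (rev xs)" "sorted (rev ys)"
    using xs ys unfolding sorted_wrt_rev is_partition_def by blast+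
  then have "sort ys = rev xs" "sort ys = rev ys"
    using eq by (auto intro: properties_for_sort)
  then show "xs = ys" by simp
qed

lemma mset_image_partitions: "mset ` {xs. is_partition xs} = {M. 0 \<notin># M}"
proof (intro equalityI subsetI)
  fix M assume "M \<in> mset ` {xs. is_partition xs}"
  then show "M \<in> {M. 0 \<notin># M}" by (auto simp: is_partition_def)
next
  fix M :: "nat multiset" assume M: "M \<in> {M. 0 \<notin># M}"
  define xs where "xs = rev (sorted_list_of_multiset M)"
  have "mset xs = M" by (simp add: xs_def)
  moreover have "is_partition xs"
  proof -
    have "sorted (rev xs)" by (simp add: xs_def)
    then show ?thesis using M unfolding sorted_wrt_rev is_partition_def by (auto simp: xs_def intro: gr0I)
  qed
  ultimately show "M \<in> mset ` {xs. is_partition xs}" by blast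
qed

text \<open>
  Parts of a partition of \<open>n\<close> are at most \<open>n < N\<close>, so the truncated products
  see all admissible parts \<open>a + d i\<close>.
\<close>

lemma card_residue_partitions:
  fixes R :: "nat set"
  assumes R: "finite R" "0 \<notin> R" "R \<subseteq> {..<d}" and nN: "n < N"
  shows "of_nat (card {xs \<in> partitions_of n. \<forall>x\<in>set xs. x mod d \<in> R})
    = (\<Prod>a\<in>R. inverse (qpoch (fps_X ^ a) (fps_X ^ d) N) :: complex fps) $ n"
proof -
  define S where "S = (\<lambda>(a, i). a + d * i) ` (R \<times> {..<N})"
  have inj: "inj_on (\<lambda>(a, i). a + d * i) (R \<times> {..<N})"
  proof (rule inj_onI, clarify)
    fix a i a' i' assume a: "a \<in> R" "a' \<in> R" and eq: "a + d * i = a' + d * i'"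
    have lt: "a < d" "a' < d" using a R(3) by auto
    have "a = a'" using arg_cong[OF eq, of "\<lambda>x. x mod d"] lt by simp
    moreover have "i = i'" using arg_cong[OF eq, of "\<lambda>x. x div d"] lt by simp
    ultimately show "a = a' \<and> i = i'" by simp
  qed
  have S: "finite S" "0 \<notin> S" using R by (auto simp: S_def)
  have mem: "x \<in> S \<longleftrightarrow> x mod d \<in> R" if "x \<le> n" for x
  proof
    assume "x \<in> S"
    then obtain a i where "a \<in> R" "x = a + d * i" by (auto simp: S_def)
    moreover from this have "a < d" using R(3) by auto
    ultimately show "x mod d \<in> R" by simp
  next
    assume x: "x mod d \<in> R"
    have "x div d \<le> x" by (rule div_le_dividend)
    then have "x div d < N" using that nN by linarith
    then have "(\<lambda>(a, i). a + d * i) (x mod d, x div d) \<in> S" unfolding S_def using x by (intro imageI) simp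
    then show "x \<in> S" by simp
  qed
  have le: "x \<le> sum_list xs" if "x \<in> set xs" for x and xs :: "nat list"
    using that by (auto intro: member_le_sum_list)
  have "mset ` {xs \<in> partitions_of n. \<forall>x\<in>set xs. x mod d \<in> R} = {M \<in> {M. set_mset M \<subseteq> S}. sum_mset M = n}"
  proof (intro equalityI subsetI)
    fix M assume "M \<in> mset ` {xs \<in> partitions_of n. \<forall>x\<in>set xs. x mod d \<in> R}"
    then show "M \<in> {M \<in> {M. set_mset M \<subseteq> S}. sum_mset M = n}"
      using mem le by (auto simp: partitions_of_def sum_mset_sum_list)
  next
    fix M assume M: "M \<in> {M \<in> {M. set_mset M \<subseteq> S}. sum_mset M = n}"
    then have "M \<in> mset ` {xs. is_partition xs}" unfolding mset_image_partitions using S(2) by auto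
    then obtain xs where xs: "is_partition xs" "M = mset xs" by auto
    have "sum_list xs = n" using M by (simp add: xs(2) sum_mset_sum_list)
    moreover have "x mod d \<in> R" if "x \<in> set xs" for x
      using M mem[of x] le[OF that] that calculation by (auto simp: xs(2))
    ultimately have "xs \<in> {xs \<in> partitions_of n. \<forall>x\<in>set xs. x mod d \<in> R}"
      using xs(1) by (simp add: partitions_of_def)
    then show "M \<in> mset ` {xs \<in> partitions_of n. \<forall>x\<in>set xs. x mod d \<in> R}"
      unfolding xs(2) by (rule imageI)
  qed
  moreover have "card (mset ` {xs \<in> partitions_of n. \<forall>x\<in>set xs. x mod d \<in> R})
      = card {xs \<in> partitions_of n. \<forall>x\<in>set xs. x mod d \<in> R}"
    by (intro card_image inj_on_subset[OF inj_on_mset_partitions]) (auto simp: partitions_of_def)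
  ultimately have "card {xs \<in> partitions_of n. \<forall>x\<in>set xs. x mod d \<in> R} = card {M \<in> {M. set_mset M \<subseteq> S}. sum_mset M = n}"
    by (simp only:)
  then have "of_nat (card {xs \<in> partitions_of n. \<forall>x\<in>set xs. x mod d \<in> R}) = gf sum_mset {M. set_mset M \<subseteq> S} $ n"
    by (simp add: gf_nth)
  also have "gf sum_mset {M. set_mset M \<subseteq> S} = (\<Prod>p\<in>R \<times> {..<N}. inverse (1 - fps_X ^ (fst p + d * snd p)))"
    unfolding gf_parts[OF S] unfolding S_def by (subst prod.reindex[OF inj]) (simp add: case_prod_unfold)
  also have "\<dots> = (\<Prod>a\<in>R. \<Prod>i<N. inverse (1 - fps_X ^ (a + d * i)))"
    by (simp add: prod.cartesian_product case_prod_unfold)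
  also have "\<dots> = (\<Prod>a\<in>R. inverse (qpoch (fps_X ^ a) (fps_X ^ d) N))"
  proof (rule prod.cong[OF refl])
    fix a
    have "inverse (\<Prod>i\<in>I. f i) = (\<Prod>i\<in>I. inverse (f i :: complex fps))" for I :: "nat set" and f
      by (induction I rule: infinite_finite_induct) (simp_all add: fps_inverse_mult)
    then show "(\<Prod>i<N. inverse (1 - fps_X ^ (a + d * i))) = inverse (qpoch (fps_X ^ a) (fps_X ^ d) N :: complex fps)"
      by (simp add: qpoch_def power_add power_mult)
  qed
  finally show ?thesis .
qed

lemma residue_condition:
  "(\<exists>r\<in>{1, 4, 6, 8::int}. [int x = r] (mod 18) \<or> [int x = - r] (mod 18)) \<longleftrightarrow> x mod 18 \<in> {1, 4, 6, 8, 10, 12, 14, 17}"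
proof -
  define y where "y = x mod 18"
  have y: "int x mod 18 = int y" by (simp add: y_def zmod_int)
  have "[int x = r] (mod 18) \<longleftrightarrow> int y = r mod 18" for r by (simp add: cong_def y)
  then show ?thesis unfolding y_def[symmetric] by (simp add: zmod_minus1) linarith
qed

text \<open>
  The number \<open>m\<close> is determined by the pair as the only value of its odd positive parts, so the sets for different
  \<open>k\<close> are disjoint; a pair with \<open>m = 2 k + 1\<close> has \<open>k \<le> n\<close> by \<open>signed_family_empty\<close>.
\<close>

lemma card_signed_partitions:
  "card {(\<pi>, \<nu>) \<in> signed_partitions_of (int n + 1).
        \<exists>m::nat. odd m \<and>
          (m \<in> set \<pi> \<and> (\<forall>x\<in>set \<pi>. odd x \<longrightarrow> x = m)) \<and>
          (length (filter even \<pi>) = m - 1 \<and> (\<forall>x\<in>set \<pi>. even x \<longrightarrow> x \<ge> m - 1)) \<and>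
          (\<forall>x\<in>set \<nu>. odd x \<and> x < m \<and> count_list \<nu> x \<le> 2)}
    = (\<Sum>k\<le>n. card (signed_family k n))" (is "card ?L = _")
proof -
  have sub: "V \<subseteq># twice_odds k \<longleftrightarrow> (\<forall>x\<in>#V. odd x \<and> x < 2 * k + 1 \<and> count V x \<le> 2)" for V k
  proof
    assume V: "V \<subseteq># twice_odds k"
    show "\<forall>x\<in>#V. odd x \<and> x < 2 * k + 1 \<and> count V x \<le> 2"
    proof
      fix x assume "x \<in># V"
      then obtain c where c: "count V x = Suc c" by (metis count_eq_zero_iff not0_implies_Suc)
      then show "odd x \<and> x < 2 * k + 1 \<and> count V x \<le> 2"
        using mset_subset_eq_count[OF V, of x] unfolding c count_twice_odds by (simp split: if_splits)
    qed
  next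
    assume V: "\<forall>x\<in>#V. odd x \<and> x < 2 * k + 1 \<and> count V x \<le> 2"
    show "V \<subseteq># twice_odds k"
    proof (rule mset_subset_eqI)
      fix x
      show "count V x \<le> count (twice_odds k) x"
      proof (cases "x \<in># V")
        case True
        then have "odd x" "x < 2 * k + 1" "count V x \<le> 2" using V by auto
        moreover from this have "x < 2 * k" by presburger
        ultimately show ?thesis by (simp add: count_twice_odds)
      qed (simp add: not_in_iff)
    qed
  qed
  let ?h = "map_prod mset mset"
  define good where "good m \<pi> \<nu> \<longleftrightarrow> odd m \<and>
          (m \<in> set \<pi> \<and> (\<forall>x\<in>set \<pi>. odd x \<longrightarrow> x = m)) \<and>
          (length (filter even \<pi>) = m - 1 \<and> (\<forall>x\<in>set \<pi>. even x \<longrightarrow> x \<ge> m - 1)) \<and>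
          (\<forall>x\<in>set \<nu>. odd x \<and> x < m \<and> count_list \<nu> x \<le> 2)" for m :: nat and \<pi> \<nu>
  have good: "?L = {(\<pi>, \<nu>) \<in> signed_partitions_of (int n + 1). \<exists>m. good m \<pi> \<nu>}"
    unfolding good_def ..
  have mem: "?h (\<pi>, \<nu>) \<in> signed_family k n \<longleftrightarrow> sum_list \<pi> = n + 1 + sum_list \<nu> \<and>
          (2 * k + 1 \<in> set \<pi> \<and> (\<forall>x\<in>set \<pi>. odd x \<longrightarrow> x = 2 * k + 1)) \<and>
          (length (filter even \<pi>) = 2 * k \<and> (\<forall>x\<in>set \<pi>. even x \<longrightarrow> x \<ge> 2 * k)) \<and>
          (\<forall>x\<in>set \<nu>. odd x \<and> x < 2 * k + 1 \<and> count_list \<nu> x \<le> 2)" for \<pi> \<nu> k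
  proof -
    have "size (filter_mset even (mset \<pi>)) = length (filter even \<pi>)"
      by (simp flip: mset_filter)
    then show ?thesis
      by (auto simp: signed_family_def sub sum_mset_sum_list count_mset)
  qed
  have "?h ` ?L = (\<Union>k\<le>n. signed_family k n)"
  proof (intro equalityI subsetI)
    fix p assume "p \<in> ?h ` ?L"
    then obtain \<pi> \<nu> where p: "p = ?h (\<pi>, \<nu>)" and L: "(\<pi>, \<nu>) \<in> ?L" by auto
    from L have "(\<pi>, \<nu>) \<in> signed_partitions_of (int n + 1) \<and> (\<exists>m. good m \<pi> \<nu>)"
      unfolding good by simp
    then obtain m where sp: "(\<pi>, \<nu>) \<in> signed_partitions_of (int n + 1)" and m: "good m \<pi> \<nu>" by blast
    have "odd m" using m unfolding good_def by (rule conjunct1)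
    then obtain k where k: "m = 2 * k + 1" by (rule oddE)
    have "int (sum_list \<pi>) = int n + 1 + int (sum_list \<nu>)" using sp by (simp add: signed_partitions_of_def)
    then have "sum_list \<pi> = n + 1 + sum_list \<nu>" by linarith
    then have "p \<in> signed_family k n" using m unfolding p mem k good_def by simp
    moreover from this have "k \<le> n" using signed_family_empty[of n k] by (cases "n < k") auto
    ultimately show "p \<in> (\<Union>k\<le>n. signed_family k n)" by auto
  next
    fix p assume "p \<in> (\<Union>k\<le>n. signed_family k n)"
    then obtain k where pk: "p \<in> signed_family k n" by auto
    obtain P V where PV: "p = (P, V)" by (cases p)
    \<comment> \<open>Positivity of the parts: an even part is at least \<open>2 k\<close>, and for \<open>k = 0\<close> there is none.\<close>
    have "0 \<notin># P"
    proof
      assume "0 \<in># P"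
      then have "2 * k \<le> 0" "0 \<in># filter_mset even P" using pk by (auto simp: PV signed_family_def)
      then show False using pk by (auto simp: PV signed_family_def)
    qed
    moreover have "0 \<notin># V"
      using pk by (auto simp: PV signed_family_def sub)
    ultimately have "P \<in> mset ` {xs. is_partition xs}" "V \<in> mset ` {xs. is_partition xs}"
      unfolding mset_image_partitions by auto
    then obtain \<pi> \<nu> where part: "is_partition \<pi>" "is_partition \<nu>" and p: "p = ?h (\<pi>, \<nu>)"
      by (auto simp: PV)
    have "sum_list \<pi> = n + 1 + sum_list \<nu>" and "good (2 * k + 1) \<pi> \<nu>"
      using pk unfolding p mem good_def by simp_all
    then have "(\<pi>, \<nu>) \<in> ?L"
      unfolding good using part by (auto simp: signed_partitions_of_def)
    then show "p \<in> ?h ` ?L" unfolding p by (rule imageI)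
  qed
  moreover have "card (?h ` ?L) = card ?L"
    by (intro card_image inj_on_subset[OF map_prod_inj_on[OF inj_on_mset_partitions inj_on_mset_partitions]])
      (auto simp: signed_partitions_of_def)
  ultimately have "card ?L = card (\<Union>k\<le>n. signed_family k n)" by (simp only:)
  also have "\<dots> = (\<Sum>k\<le>n. card (signed_family k n))"
    by (intro card_UN_disjoint) (auto simp: finite_signed_family dest: signed_family_disjoint)
  finally show ?thesis .
qed

theorem theorem4p13:
  fixes n :: nat
  shows
    "card {(\<pi>, \<nu>) \<in> signed_partitions_of (int n + 1).
        \<exists>m::nat. odd m \<and>
          (m \<in> set \<pi> \<and> (\<forall>x\<in>set \<pi>. odd x \<longrightarrow> x = m)) \<and>
          (length (filter even \<pi>) = m - 1 \<and> (\<forall>x\<in>set \<pi>. even x \<longrightarrow> x \<ge> m - 1)) \<and>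
          (\<forall>x\<in>set \<nu>. odd x \<and> x < m \<and> count_list \<nu> x \<le> 2)}
     = card {xs \<in> partitions_of n.
        \<forall>x\<in>set xs. \<exists>r\<in>{1, 4, 6, 8::int}. [int x = r] (mod 18) \<or> [int x = - r] (mod 18)}"
    (is "card ?L = card ?R")
proof -
  \<comment> \<open>Coefficients up to order \<open>n\<close> are needed; \<open>6 N\<close> is long enough for the truncated identity and divisible by 3.\<close>
  define N where "N = n + 1"
  define t where "t k = (fps_X ^ (2 * k * (k + 1)) * cubic_poch fps_X k * inverse (1 - fps_X ^ (2 * k + 1))
      * rfac (fps_X ^ 2) (2 * k) :: complex fps)" for k
  have "of_nat (card ?L) = (\<Sum>k\<le>n. of_nat (card (signed_family k n)) :: complex)"
    unfolding card_signed_partitions by simp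
  also have "\<dots> = (\<Sum>k\<le>6 * N. of_nat (card (signed_family k n)))"
    by (rule sum.mono_neutral_left) (auto simp: N_def signed_family_empty)
  also have "\<dots> = (\<Sum>k\<le>6 * N. t k) $ n"
    unfolding fps_sum_nth t_def card_signed_family ..
  also have "\<dots> = (\<Prod>a\<in>{1, 4, 6, 8, 10, 12, 14, 17}. inverse (qpoch (fps_X ^ a) (fps_X ^ 18) N)) $ n"
    using Slater_mod_18_upto[of N "6 * N"] unfolding cong_upto_def t_def[symmetric] by (simp add: N_def)
  also have "\<dots> = of_nat (card {xs \<in> partitions_of n. \<forall>x\<in>set xs. x mod 18 \<in> {1, 4, 6, 8, 10, 12, 14, 17}})"
    by (rule card_residue_partitions[symmetric]) (auto simp: N_def)
  also have "{xs \<in> partitions_of n. \<forall>x\<in>set xs. x mod 18 \<in> {1, 4, 6, 8, 10, 12, 14, 17}} = ?R"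
    unfolding residue_condition ..
  finally show ?thesis by (simp only: of_nat_eq_iff)
qed

end
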